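(* Let $H$ be the diagonal subgroup of $SU(n)$ and let $\mathcal O$ be the coadjoint orbit of an element of $\mathfrak{su}(n)^*$ whose stabilizer contains $H$. Let $X=(x_1,\dots,x_n)$ and $X'=(x'_1,\dots,x'_n)$ be elements of $\mathfrak h$ (diagonal matrices in $\mathfrak{su}(n)$) lying in $(2\pi i\mathbb Z)^n$. If there exists a permutation $\tau$ of the set $\{1,\dots,n\}$ such that $x'_j=x_{\tau(j)}$ for all $j$, then the circle actions defined by $X$ and $X'$ on the orbit $\mathcal O$ of $SU(n)$ are $\sim$-equivalent.
   Context: $(x_1,\dots,x_n)$ denotes the diagonal matrix with these entries. $\mathcal O$ carries its standard (Kirillov–Kostant–Souriau) symplectic structure. A diagonal $X\in\mathfrak{su}(n)$ with entries in $2\pi i\mathbb Z$ defines the Hamiltonian circle action $t\in\mathbb R/\mathbb Z\mapsto(\nu\mapsto e^{tX}\cdot\nu)$ on $\mathcal O$, where $\cdot$ is the coadjoint action. $\mathrm{Ham}(\mathcal O)$ is the group of Hamiltonian diffeomorphisms with its usual ($C^\infty$) topology. Two Hamiltonian circle actions $\psi,\psi':U(1)\to\mathrm{Ham}(\mathcal O)$ are $\sim$-equivalent if there is a continuous family $\{\psi^s:U(1)\to\mathrm{Ham}(\mathcal O)\}_{s\in[0,1]}$ of Lie group homomorphisms with $\psi^0=\psi$ and $\psi^1=\psi'$. *)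

theory Defs
  imports "HOL-Analysis.Analysis"
begin

section \<open>The group \<open>SU(n)\<close>, its Lie algebra and the dual of the Lie algebra\<close>

definition ctranspose :: "complex^'n^'m \<Rightarrow> complex^'m^'n" where
  "ctranspose A = map_matrix cnj (transpose A)"

definition SU :: "(complex^'n^'n) set" where
  "SU = {g. g ** ctranspose g = mat 1 \<and> det g = 1}"

definition diag :: "complex^'n \<Rightarrow> complex^'n^'n" where
  "diag x = (\<chi> i j. if i = j then x $ i else 0)"

definition SU_diag :: "(complex^'n^'n) set" where
  "SU_diag = SU \<inter> range diag"

definition mat_exp :: "complex^'n^'n \<Rightarrow> complex^'n^'n" where
  "mat_exp A = (\<Sum>k. (1 / fact k) *\<^sub>R (((**) A ^^ k) (mat 1)))"

definition su_matrices :: "(complex^'n^'n) set" where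
  "su_matrices = {A. ctranspose A = - A \<and> trace A = 0}"

lemma ctranspose_nth [simp]: "ctranspose A $ i $ j = cnj (A $ j $ i)"
  by (simp add: ctranspose_def transpose_def)

lemma ctranspose_zero [simp]: "ctranspose 0 = 0"
  by (simp add: vec_eq_iff)

lemma ctranspose_minus: "ctranspose (- A) = - ctranspose A"
  by (simp add: vec_eq_iff)

lemma ctranspose_add: "ctranspose (A + B) = ctranspose A + ctranspose B"
  by (simp add: vec_eq_iff)

lemma ctranspose_diff: "ctranspose (A - B) = ctranspose A - ctranspose B"
  by (simp add: vec_eq_iff)

lemma ctranspose_scaleR: "ctranspose (c *\<^sub>R A) = c *\<^sub>R ctranspose A"
  by (simp add: vec_eq_iff)

lemma ctranspose_mult: "ctranspose (A ** B) = ctranspose B ** ctranspose A"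
  by (simp add: vec_eq_iff matrix_matrix_mult_def mult.commute)

lemma ctranspose_ctranspose [simp]: "ctranspose (ctranspose A) = A"
  by (simp add: vec_eq_iff)

lemma trace_zero [simp]: "trace (0 :: complex^'n^'n) = 0"
  by (simp add: trace_def)

lemma trace_minus: "trace (- A :: complex^'n^'n) = - trace A"
  by (simp add: trace_def sum_negf)

lemma trace_scaleR: "trace (c *\<^sub>R A :: complex^'n^'n) = c *\<^sub>R trace A"
  by (simp add: trace_def scaleR_sum_right)

lemma matrix_mult_uminus_left: "(- A) ** B = - (A ** B)"
  for A B :: "complex^'n^'n"
  by (simp add: vec_eq_iff matrix_matrix_mult_def sum_negf)

lemma matrix_mult_uminus_right: "A ** (- B) = - (A ** B)"
  for A B :: "complex^'n^'n"
  by (simp add: vec_eq_iff matrix_matrix_mult_def sum_negf)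

typedef 'n su = "su_matrices :: (complex^'n::finite^'n) set"
proof
  show "0 \<in> su_matrices" by (simp add: su_matrices_def)
qed

setup_lifting type_definition_su

instantiation su :: (finite) real_normed_vector
begin

lift_definition zero_su :: "'a su" is 0
  by (simp add: su_matrices_def)

lift_definition plus_su :: "'a su \<Rightarrow> 'a su \<Rightarrow> 'a su" is "(+)"
  by (simp add: su_matrices_def ctranspose_add trace_add)

lift_definition minus_su :: "'a su \<Rightarrow> 'a su \<Rightarrow> 'a su" is "(-)"
  by (simp add: su_matrices_def ctranspose_diff trace_sub)

lift_definition uminus_su :: "'a su \<Rightarrow> 'a su" is uminus
  by (simp add: su_matrices_def ctranspose_minus trace_minus)

lift_definition scaleR_su :: "real \<Rightarrow> 'a su \<Rightarrow> 'a su" is scaleR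
  by (simp add: su_matrices_def ctranspose_scaleR trace_scaleR)

lift_definition norm_su :: "'a su \<Rightarrow> real" is norm .

definition dist_su :: "'a su \<Rightarrow> 'a su \<Rightarrow> real" where
  "dist_su A B = norm (A - B)"

definition sgn_su :: "'a su \<Rightarrow> 'a su" where
  "sgn_su A = inverse (norm A) *\<^sub>R A"

definition uniformity_su :: "('a su \<times> 'a su) filter" where
  "uniformity_su = (INF e\<in>{0 <..}. principal {(x, y). dist x y < e})"

definition open_su :: "'a su set \<Rightarrow> bool" where
  "open_su U = (\<forall>x\<in>U. eventually (\<lambda>(x', y). x' = x \<longrightarrow> y \<in> U) uniformity)"

instance
proof
  fix A B C :: "'a su" and r s :: real and U :: "'a su set"
  show "A + B + C = A + (B + C)" by transfer (rule add.assoc)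
  show "A + B = B + A" by transfer (rule add.commute)
  show "0 + A = A" "- A + A = 0" by (transfer, simp)+
  show "A - B = A + - B" by transfer (rule diff_conv_add_uminus)
  show "r *\<^sub>R (A + B) = r *\<^sub>R A + r *\<^sub>R B" by transfer (rule scaleR_add_right)
  show "(r + s) *\<^sub>R A = r *\<^sub>R A + s *\<^sub>R A" by transfer (rule scaleR_add_left)
  show "r *\<^sub>R s *\<^sub>R A = (r * s) *\<^sub>R A" "1 *\<^sub>R A = A" by (transfer, simp)+
  show "norm (r *\<^sub>R A) = \<bar>r\<bar> * norm A" by transfer simp
  show "(norm A = 0) = (A = 0)" by transfer simp
  show "norm (A + B) \<le> norm A + norm B" by transfer (rule norm_triangle_ineq)
qed (rule dist_su_def sgn_su_def uniformity_su_def open_su_def)+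

end

text \<open>Since \<open>su(n)\<close> is finite-dimensional, every linear functional is bounded, so
  bounded linear functionals are the full dual.\<close>

type_synonym 'n su_dual = "'n su \<Rightarrow>\<^sub>L real"

lift_definition bracket :: "'n::finite su \<Rightarrow> 'n su \<Rightarrow> 'n su" is "\<lambda>A B. A ** B - B ** A"
proof -
  fix A B :: "complex^'n^'n"
  assume "A \<in> su_matrices" "B \<in> su_matrices"
  then have "ctranspose A = - A" "ctranspose B = - B" by (simp_all add: su_matrices_def)
  then have "ctranspose (A ** B - B ** A) = - (A ** B - B ** A)"
    by (simp add: ctranspose_diff ctranspose_mult matrix_mult_uminus_left matrix_mult_uminus_right)
  moreover have "trace (A ** B - B ** A) = 0"
    using trace_mul_sym[of A B] by (simp add: trace_sub)
  ultimately show "A ** B - B ** A \<in> su_matrices" by (simp add: su_matrices_def)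
qed

section \<open>Coadjoint action and coadjoint orbits\<close>

text \<open>The following two definitions are meaningful for \<open>g \<in> SU\<close>; see \<open>Rep_su_Ad\<close>
  and \<open>coAd_apply\<close> below.\<close>

definition Ad :: "complex^'n::finite^'n \<Rightarrow> 'n su \<Rightarrow> 'n su" where
  "Ad g Z = Abs_su (g ** Rep_su Z ** matrix_inv g)"

definition coAd :: "complex^'n::finite^'n \<Rightarrow> 'n su_dual \<Rightarrow> 'n su_dual" where
  "coAd g \<nu> = Blinfun (\<lambda>Z. blinfun_apply \<nu> (Ad (matrix_inv g) Z))"

definition coadjoint_orbit :: "'n::finite su_dual \<Rightarrow> 'n su_dual set" where
  "coadjoint_orbit \<eta> = (\<lambda>g. coAd g \<eta>) ` SU"

definition stabilizer :: "'n::finite su_dual \<Rightarrow> (complex^'n^'n) set" where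
  "stabilizer \<eta> = {g \<in> SU. coAd g \<eta> = \<eta>}"

text \<open>The infinitesimal coadjoint action, i.e. the derivative of
  \<open>t \<mapsto> coAd (mat_exp (t Y)) \<nu>\<close> at \<open>0\<close>.\<close>

definition coad :: "'n::finite su \<Rightarrow> 'n su_dual \<Rightarrow> 'n su_dual" where
  "coad Y \<nu> = Blinfun (\<lambda>Z. - blinfun_apply \<nu> (bracket Y Z))"

definition tangent :: "'n::finite su_dual \<Rightarrow> 'n su_dual set" where
  "tangent \<nu> = range (\<lambda>Y. coad Y \<nu>)"

text \<open>The Kirillov--Kostant--Souriau form at \<open>\<nu>\<close>, defined for vectors in \<open>tangent \<nu>\<close>;
  it is well defined by \<open>kks_coad\<close> below.\<close>

definition kks :: "'n::finite su_dual \<Rightarrow> 'n su_dual \<Rightarrow> 'n su_dual \<Rightarrow> real" where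
  "kks \<nu> v w = (THE r. \<exists>Y Z. v = coad Y \<nu> \<and> w = coad Z \<nu> \<and> r = blinfun_apply \<nu> (bracket Y Z))"

lemma SU_inverse:
  assumes "g \<in> SU"
  shows "matrix_inv g = ctranspose g"
proof -
  have 1: "g ** ctranspose g = mat 1" using assms by (simp add: SU_def)
  then have 2: "ctranspose g ** g = mat 1" by (simp add: matrix_left_right_inverse)
  have "g ** matrix_inv g = mat 1 \<and> matrix_inv g ** g = mat 1"
    unfolding matrix_inv_def by (rule someI[of _ "ctranspose g"]) (simp add: 1 2)
  then have "matrix_inv g ** (g ** ctranspose g) = ctranspose g"
    by (simp add: matrix_mul_assoc)
  then show ?thesis by (simp add: 1)
qed

lemma SU_matrix_inv:
  assumes "g \<in> SU"
  shows "matrix_inv g \<in> SU"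
proof -
  have 1: "g ** ctranspose g = mat 1" "det g = 1" using assms by (simp_all add: SU_def)
  then have 2: "ctranspose g ** g = mat 1" by (simp add: matrix_left_right_inverse)
  have "det (ctranspose g) = 1" using arg_cong[OF 2, of det] 1 by (simp add: det_mul det_I)
  then show ?thesis using 2 by (simp add: SU_inverse[OF assms]) (simp add: SU_def)
qed

lemma Rep_su_Ad:
  fixes g :: "complex^'n::finite^'n"
  assumes "g \<in> SU"
  shows "Rep_su (Ad g Z) = g ** Rep_su Z ** matrix_inv g"
proof -
  have Z: "ctranspose (Rep_su Z) = - Rep_su Z" "trace (Rep_su Z) = 0"
    using Rep_su[of Z] by (auto simp: su_matrices_def)
  have inv: "matrix_inv g = ctranspose g" by (rule SU_inverse[OF assms])
  have "g ** ctranspose g = mat 1" using assms by (simp add: SU_def)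
  then have 2: "ctranspose g ** g = mat 1" by (simp add: matrix_left_right_inverse)
  have "trace (g ** Rep_su Z ** ctranspose g) = trace (ctranspose g ** (g ** Rep_su Z))"
    by (rule trace_mul_sym)
  also have "\<dots> = trace (Rep_su Z)" by (simp add: matrix_mul_assoc 2)
  finally have "g ** Rep_su Z ** ctranspose g \<in> su_matrices"
    using Z by (simp add: su_matrices_def ctranspose_mult matrix_mult_uminus_left
        matrix_mult_uminus_right matrix_mul_assoc)
  then show ?thesis by (simp add: Ad_def inv Abs_su_inverse)
qed

lemma bounded_linear_matrix_mult:
  "bounded_linear (\<lambda>X :: complex^'n::finite^'n. A ** X ** B)"
proof -
  have "linear (\<lambda>X :: complex^'n::finite^'n. A ** X ** B)"
    by (rule linearI)
      (simp_all add: vec_eq_iff matrix_matrix_mult_def algebra_simps sum.distrib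
        scaleR_sum_right sum_distrib_left)
  then show ?thesis by (simp add: linear_conv_bounded_linear)
qed

lemma bounded_linear_Ad:
  fixes g :: "complex^'n::finite^'n"
  assumes "g \<in> SU"
  shows "bounded_linear (Ad g)"
proof -
  interpret M: bounded_linear "\<lambda>X :: complex^'n^'n. g ** X ** matrix_inv g"
    by (rule bounded_linear_matrix_mult)
  show ?thesis
  proof (rule bounded_linear_intro[where K = "onorm (\<lambda>X :: complex^'n^'n. g ** X ** matrix_inv g)"])
    show "Ad g (X + Y) = Ad g X + Ad g Y" for X Y
      using M.add[of "Rep_su X" "Rep_su Y"]
      by (simp add: Rep_su_inject[symmetric] Rep_su_Ad[OF assms] plus_su.rep_eq)
    show "Ad g (r *\<^sub>R X) = r *\<^sub>R Ad g X" for r X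
      using M.scaleR[of r "Rep_su X"]
      by (simp add: Rep_su_inject[symmetric] Rep_su_Ad[OF assms] scaleR_su.rep_eq)
    show "norm (Ad g X) \<le> norm X * onorm (\<lambda>X :: complex^'n^'n. g ** X ** matrix_inv g)" for X
      using onorm[OF M.bounded_linear_axioms, of "Rep_su X"]
      by (simp add: norm_su.rep_eq Rep_su_Ad[OF assms] mult.commute)
  qed
qed

lemma coAd_apply:
  assumes "g \<in> SU"
  shows "blinfun_apply (coAd g \<nu>) Z = blinfun_apply \<nu> (Ad (matrix_inv g) Z)"
proof -
  have "bounded_linear (\<lambda>Z. blinfun_apply \<nu> (Ad (matrix_inv g) Z))"
    by (rule bounded_linear_compose[OF blinfun.bounded_linear_right
          bounded_linear_Ad[OF SU_matrix_inv[OF assms]]])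
  then show ?thesis by (simp add: coAd_def bounded_linear_Blinfun_apply)
qed

lemma bounded_linear_bracket: "bounded_linear (bracket Y)"
  for Y :: "'n::finite su"
proof -
  define h where "h = (\<lambda>X :: complex^'n^'n. Rep_su Y ** X ** mat 1 - mat 1 ** X ** Rep_su Y)"
  have "bounded_linear h"
    unfolding h_def by (intro bounded_linear_sub bounded_linear_matrix_mult)
  then interpret h: bounded_linear h .
  have rep: "Rep_su (bracket Y Z) = h (Rep_su Z)" for Z
    by (simp add: h_def bracket.rep_eq)
  show ?thesis
  proof (rule bounded_linear_intro[where K = "onorm h"])
    show "bracket Y (X + Z) = bracket Y X + bracket Y Z" for X Z
      by (simp add: Rep_su_inject[symmetric] rep plus_su.rep_eq h.add)
    show "bracket Y (r *\<^sub>R X) = r *\<^sub>R bracket Y X" for r X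
      by (simp add: Rep_su_inject[symmetric] rep scaleR_su.rep_eq h.scaleR)
    show "norm (bracket Y X) \<le> norm X * onorm h" for X
      using onorm[OF h.bounded_linear_axioms, of "Rep_su X"]
      by (simp add: norm_su.rep_eq rep mult.commute)
  qed
qed

lemma coad_apply: "blinfun_apply (coad Y \<nu>) Z = - blinfun_apply \<nu> (bracket Y Z)"
proof -
  have "bounded_linear (\<lambda>Z. - blinfun_apply \<nu> (bracket Y Z))"
    by (rule bounded_linear_minus, rule bounded_linear_compose[where f = "blinfun_apply \<nu>"])
      (rule blinfun.bounded_linear_right bounded_linear_bracket)+
  then show ?thesis by (simp add: coad_def bounded_linear_Blinfun_apply)
qed

lemma bracket_commute: "bracket Y Z = - bracket Z Y"
  by transfer simp

lemma kks_coad: "kks \<nu> (coad Y \<nu>) (coad Z \<nu>) = blinfun_apply \<nu> (bracket Y Z)"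
proof -
  have left: "blinfun_apply \<nu> (bracket A B) = - blinfun_apply (coad A \<nu>) B" for A B
    by (simp add: coad_apply)
  have right: "blinfun_apply \<nu> (bracket A B) = blinfun_apply (coad B \<nu>) A" for A B
    by (subst bracket_commute) (simp add: coad_apply blinfun.minus_right)
  have "r = blinfun_apply \<nu> (bracket Y Z)"
    if "coad Y \<nu> = coad Y' \<nu>" "coad Z \<nu> = coad Z' \<nu>" "r = blinfun_apply \<nu> (bracket Y' Z')"
    for r Y' Z'
    using that left[of Y' Z'] left[of Y Z'] right[of Y Z'] right[of Y Z] by metis
  then show ?thesis unfolding kks_def by (intro the_equality) blast+
qed

section \<open>Smooth maps\<close>

text \<open>\<open>Ck k U f\<close>: \<open>f\<close> is \<open>k\<close> times continuously differentiable on the open set \<open>U\<close>,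
  phrased with directional derivatives. All spaces to which it is applied here are
  finite-dimensional, where this is the usual notion.\<close>

primrec Ck :: "nat \<Rightarrow> 'a::real_normed_vector set \<Rightarrow> ('a \<Rightarrow> 'b::real_normed_vector) \<Rightarrow> bool" where
  "Ck 0 U f \<longleftrightarrow> continuous_on U f"
| "Ck (Suc k) U f \<longleftrightarrow> (\<forall>x\<in>U. f differentiable (at x)) \<and>
     (\<forall>v. Ck k U (\<lambda>x. frechet_derivative f (at x) v))"

text \<open>Smoothness on an arbitrary subset \<open>S\<close> means local extendability to smooth maps on open
  sets. \<open>SU(n)\<close> is compact, so coadjoint orbits are compact embedded submanifolds of the
  dual space, and for \<open>S\<close> a coadjoint orbit this is smoothness for the manifold structure.\<close>

definition smooth_on :: "'a::real_normed_vector set \<Rightarrow> ('a \<Rightarrow> 'b::real_normed_vector) \<Rightarrow> bool" where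
  "smooth_on S f \<longleftrightarrow> (\<forall>x\<in>S. \<exists>U F. open U \<and> x \<in> U \<and> (\<forall>k. Ck k U F) \<and> (\<forall>y\<in>S \<inter> U. F y = f y))"

section \<open>Hamiltonian diffeomorphisms of a coadjoint orbit\<close>

text \<open>Below, \<open>M\<close> is a coadjoint orbit. Maps on \<open>M\<close> are represented by extensional functions.\<close>

definition diffeos :: "'n::finite su_dual set \<Rightarrow> ('n su_dual \<Rightarrow> 'n su_dual) set" where
  "diffeos M = {f \<in> extensional M. bij_betw f M M \<and> smooth_on M f \<and> smooth_on M (inv_into M f)}"

text \<open>\<open>v\<close> is the value at \<open>\<nu>\<close> of the Hamiltonian vector field of \<open>h\<close>. The derivative within
  \<open>M\<close> is uniquely determined on vectors tangent to \<open>M\<close>, and it is only applied to such.\<close>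

definition ham_vector ::
    "'n::finite su_dual set \<Rightarrow> ('n su_dual \<Rightarrow> real) \<Rightarrow> 'n su_dual \<Rightarrow> 'n su_dual \<Rightarrow> bool" where
  "ham_vector M h \<nu> v \<longleftrightarrow> v \<in> tangent \<nu> \<and>
     (\<forall>w\<in>tangent \<nu>. kks \<nu> v w = frechet_derivative h (at \<nu> within M) w)"

definition hamiltonian_isotopy ::
    "'n::finite su_dual set \<Rightarrow> (real \<Rightarrow> 'n su_dual \<Rightarrow> 'n su_dual) \<Rightarrow> bool" where
  "hamiltonian_isotopy M \<Phi> \<longleftrightarrow>
     (\<forall>t\<in>{0..1}. \<Phi> t \<in> diffeos M) \<and>
     smooth_on ({0..1} \<times> M) (\<lambda>(t, \<nu>). \<Phi> t \<nu>) \<and>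
     \<Phi> 0 = (\<lambda>\<nu>\<in>M. \<nu>) \<and>
     (\<exists>h :: real \<Rightarrow> 'n su_dual \<Rightarrow> real.
        smooth_on ({0..1} \<times> M) (\<lambda>(t, \<nu>). h t \<nu>) \<and>
        (\<forall>t\<in>{0..1}. \<forall>\<nu>\<in>M. \<exists>v. ham_vector M (h t) (\<Phi> t \<nu>) v \<and>
           ((\<lambda>t. \<Phi> t \<nu>) has_vector_derivative v) (at t within {0..1})))"

definition Ham :: "'n::finite su_dual set \<Rightarrow> ('n su_dual \<Rightarrow> 'n su_dual) set" where
  "Ham M = {\<phi>. \<exists>\<Phi>. hamiltonian_isotopy M \<Phi> \<and> \<phi> = \<Phi> 1}"

section \<open>The \<open>C\<^sup>\<infinity>\<close> topology\<close>

definition vector_fields :: "'n::finite su_dual set \<Rightarrow> ('n su_dual \<Rightarrow> 'n su_dual) set" where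
  "vector_fields M = {V. smooth_on M V \<and> (\<forall>\<nu>\<in>M. V \<nu> \<in> tangent \<nu>)}"

text \<open>\<open>iter_deriv M [V\<^sub>1, \<dots>, V\<^sub>k] f\<close> is the iterated derivative of \<open>f\<close> along the vector
  fields \<open>V\<^sub>1, \<dots>, V\<^sub>k\<close> on \<open>M\<close>.\<close>

primrec iter_deriv :: "'n::finite su_dual set \<Rightarrow> ('n su_dual \<Rightarrow> 'n su_dual) list \<Rightarrow>
    ('n su_dual \<Rightarrow> 'n su_dual) \<Rightarrow> 'n su_dual \<Rightarrow> 'n su_dual" where
  "iter_deriv M [] f = f"
| "iter_deriv M (V # Vs) f =
     (\<lambda>\<nu>. frechet_derivative (iter_deriv M Vs f) (at \<nu> within M) (V \<nu>))"

text \<open>The \<open>C\<^sup>\<infinity>\<close> topology on maps of the compact manifold \<open>M\<close> into the ambient vector space is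
  given by the seminorms \<open>sup\<^sub>M \<parallel>V\<^sub>1 \<dots> V\<^sub>k f\<parallel>\<close>; \<open>Ham M\<close> carries the subspace topology.\<close>

definition Ham_topology :: "'n::finite su_dual set \<Rightarrow> ('n su_dual \<Rightarrow> 'n su_dual) topology" where
  "Ham_topology M = topology_generated_by
     {{g \<in> Ham M. \<forall>\<nu>\<in>M. norm (iter_deriv M Vs (\<lambda>\<mu>. g \<mu> - f \<mu>) \<nu>) < \<epsilon>} | f Vs \<epsilon>.
        f \<in> Ham M \<and> set Vs \<subseteq> vector_fields M \<and> \<epsilon> > 0}"

section \<open>Circle actions and their equivalence\<close>

text \<open>The circle \<open>U(1)\<close> is taken as \<open>\<real>/\<int>\<close>, and a homomorphism on it is represented by the
  homomorphism on \<open>\<real>\<close> that it induces, which is trivial at \<open>1\<close>. A map into \<open>Ham M\<close> is smooth if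
  the corresponding map on \<open>\<real> \<times> M\<close> is.\<close>

definition ham_circle_action ::
    "'n::finite su_dual set \<Rightarrow> (real \<Rightarrow> 'n su_dual \<Rightarrow> 'n su_dual) \<Rightarrow> bool" where
  "ham_circle_action M \<psi> \<longleftrightarrow>
     (\<forall>t. \<psi> t \<in> Ham M) \<and>
     (\<forall>s t. \<psi> (s + t) = compose M (\<psi> s) (\<psi> t)) \<and>
     \<psi> 1 = (\<lambda>\<nu>\<in>M. \<nu>) \<and>
     smooth_on (UNIV \<times> M) (\<lambda>(t, \<nu>). \<psi> t \<nu>)"

definition circle_equiv ::
    "'n::finite su_dual set \<Rightarrow> (real \<Rightarrow> 'n su_dual \<Rightarrow> 'n su_dual) \<Rightarrow>
     (real \<Rightarrow> 'n su_dual \<Rightarrow> 'n su_dual) \<Rightarrow> bool" where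
  "circle_equiv M \<psi> \<psi>' \<longleftrightarrow>
     ham_circle_action M \<psi> \<and> ham_circle_action M \<psi>' \<and>
     (\<exists>\<Psi> :: real \<Rightarrow> real \<Rightarrow> 'n su_dual \<Rightarrow> 'n su_dual.
        (\<forall>s\<in>{0..1}. ham_circle_action M (\<Psi> s)) \<and>
        continuous_map (top_of_set ({0..1} \<times> UNIV)) (Ham_topology M) (\<lambda>(s, t). \<Psi> s t) \<and>
        \<Psi> 0 = \<psi> \<and> \<Psi> 1 = \<psi>')"

definition circle_action ::
    "'n::finite su_dual set \<Rightarrow> complex^'n^'n \<Rightarrow> real \<Rightarrow> 'n su_dual \<Rightarrow> 'n su_dual" where
  "circle_action M X t = (\<lambda>\<nu>\<in>M. coAd (mat_exp (t *\<^sub>R X)) \<nu>)"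

end

theory Submission
  imports Defs
begin

text \<open>
  The diagonal matrices \<open>X\<close> and \<open>X'\<close> are conjugate in \<open>SU(n)\<close>: a permutation matrix for \<open>\<tau>\<close>,
  with some signs changed to make the determinant \<open>1\<close>, carries one to the other. Such a matrix
  can be joined to the identity by a path \<open>k\<close> in \<open>SU(n)\<close>, and
  \<open>\<Psi> s t = coAd (k\<^sub>s e\<^sup>t\<^sup>X k\<^sub>s\<^sup>*)\<close>
  is the required family. It starts at the action of \<open>X\<close>, ends at the action of \<open>X'\<close>, and each
  member is periodic in \<open>t\<close> because \<open>e\<^sup>X\<close> is the identity matrix. The path is a product of quarter
  turns in coordinate planes (\<open>SU_path_to_permutation\<close>).

  Three things have to be shown about the family.

  Each member acts by Hamiltonian diffeomorphisms. This holds for the action of any one-parameter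
  subgroup of \<open>SU(n)\<close> with generator \<open>Y\<close>: the function \<open>\<nu> \<mapsto> \<nu>(Y)\<close> is a Hamiltonian for it
  (\<open>hamiltonian_isotopy_act\<close>). The derivative of this function within the orbit is meaningful on
  tangent vectors only. There it is unique because every tangent vector \<open>coad Z \<nu>\<close> is the velocity
  of a curve \<open>coAd (e\<^sup>t\<^sup>Z) \<nu>\<close> in the orbit (\<open>has_derivative_within_unique_on_tangent\<close>), and this
  needs \<open>e\<^sup>t\<^sup>Z \<in> SU(n)\<close> (\<open>mat_exp_in_SU\<close>).

  Each member is smooth in time and space together. Since \<open>coAd\<close> is linear in \<open>\<nu>\<close>, it suffices to
  follow the derivatives of \<open>(t, \<nu>) \<mapsto> coAd (g t) (a + L \<nu>)\<close> with \<open>L\<close> linear, and this class of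
  maps is closed under directional derivatives (\<open>Ck_flow\<close>).

  The family is continuous in the \<open>C\<^sup>\<infinity>\<close> topology. Iterated derivatives along vector fields of a
  smooth map are again smooth on the orbit (\<open>smooth_on_iter_deriv\<close>), hence bounded, and they
  commute with linear maps applied to the values (\<open>iter_deriv_add_linear\<close>). As the action is the
  restriction of a linear map that depends continuously on the group element, all seminorms are
  controlled by its operator norm (\<open>continuous_map_into_Ham_topology\<close>).

  Calculations in the dual of the Lie algebra use the expansion of functionals in a finite spanning
  family (\<open>su_dual_expansion\<close>).
\<close>

section \<open>Curves in the special unitary group\<close>

lemma has_vector_derivative_vecI:
  fixes f :: "real \<Rightarrow> 'a::real_normed_vector^'n"
  assumes "\<And>i. ((\<lambda>t. f t $ i) has_vector_derivative D $ i) (at t)"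
  shows "(f has_vector_derivative D) (at t)"
  unfolding has_vector_derivative_def has_derivative_def
proof (intro conjI bounded_linear_scaleR_left vec_tendstoI)
  fix i
  show "((\<lambda>y. ((f y - f (Lim (at t) (\<lambda>x. x)) - (y - Lim (at t) (\<lambda>x. x)) *\<^sub>R D) /\<^sub>R
      norm (y - Lim (at t) (\<lambda>x. x))) $ i) \<longlongrightarrow> 0 $ i) (at t)"
    using assms[of i] unfolding has_vector_derivative_def has_derivative_def by simp
qed

lemma has_vector_derivative_matrixI:
  fixes f :: "real \<Rightarrow> 'a::real_normed_vector^'n^'m"
  assumes "\<And>i j. ((\<lambda>t. f t $ i $ j) has_vector_derivative D $ i $ j) (at t)"
  shows "(f has_vector_derivative D) (at t)"
  by (intro has_vector_derivative_vecI assms)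

lemma bounded_bilinear_matrix_mult:
  "bounded_bilinear ((**) :: complex^'n::finite^'n \<Rightarrow> complex^'n^'n \<Rightarrow> complex^'n^'n)"
  unfolding bilinear_conv_bounded_bilinear[symmetric] bilinear_def
  by (auto intro!: linearI simp: vec_eq_iff matrix_matrix_mult_def algebra_simps sum.distrib
      scaleR_sum_right sum_distrib_left)

interpretation matrix_mult:
  bounded_bilinear "(**) :: complex^'n::finite^'n \<Rightarrow> complex^'n^'n \<Rightarrow> complex^'n^'n"
  by (rule bounded_bilinear_matrix_mult)

lemma bounded_linear_ctranspose:
  "bounded_linear (ctranspose :: complex^'n::finite^'n \<Rightarrow> complex^'n^'n)"
  unfolding linear_conv_bounded_linear[symmetric]
  by (intro linearI) (simp_all add: ctranspose_add ctranspose_scaleR)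

lemmas has_vector_derivative_ctranspose =
  bounded_linear.has_vector_derivative[OF bounded_linear_ctranspose]
lemmas continuous_on_ctranspose [continuous_intros] =
  bounded_linear.continuous_on[OF bounded_linear_ctranspose]
lemmas has_vector_derivative_matrix_mult = matrix_mult.has_vector_derivative

lemma SU_D:
  assumes "g \<in> SU"
  shows "g ** ctranspose g = mat 1" "ctranspose g ** g = mat 1" "det g = 1"
  using assms by (simp_all add: SU_def matrix_left_right_inverse)

lemma ctranspose_mat_1 [simp]: "ctranspose (mat 1 :: complex^'n^'n) = mat 1"
  by (simp add: vec_eq_iff mat_def)

lemma mat_1_in_SU [simp]: "mat 1 \<in> SU"
  by (simp add: SU_def)

lemma SU_ctranspose: "g \<in> SU \<Longrightarrow> ctranspose g \<in> SU"
  using SU_matrix_inv SU_inverse by metis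

lemma SU_mult:
  fixes g h :: "complex^'n::finite^'n"
  assumes "g \<in> SU" "h \<in> SU"
  shows "g ** h \<in> SU"
proof -
  have "g ** h ** ctranspose (g ** h) = g ** (h ** ctranspose h) ** ctranspose g"
    by (simp only: ctranspose_mult matrix_mul_assoc)
  then show ?thesis using assms by (simp add: SU_def det_mul)
qed

text \<open>Jacobi's formula at the identity. In the Leibniz expansion, the product of a permutation other
  than the identity has at least two factors that vanish at time \<open>t\<close>, so only the product of the
  diagonal entries contributes to first order.\<close>

lemma det_has_vector_derivative_at_mat_1:
  fixes V :: "real \<Rightarrow> complex^'n::finite^'n"
  assumes V: "(V has_vector_derivative Z) (at t)" and 1: "V t = mat 1"
  shows "((\<lambda>s. det (V s)) has_vector_derivative trace Z) (at t)"
proof -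
  have comp: "((\<lambda>s. V s $ i $ j) has_derivative (\<lambda>h. h *\<^sub>R (Z $ i $ j))) (at t)" for i j
    using bounded_linear.has_derivative[OF bounded_linear_vec_nth
        bounded_linear.has_derivative[OF bounded_linear_vec_nth V[unfolded has_vector_derivative_def]]]
    by simp
  let ?P = "{p. p permutes (UNIV :: 'n set)}"
  have "((\<lambda>s. det (V s)) has_derivative (\<lambda>h. \<Sum>p\<in>?P. of_int (sign p) *
      (\<Sum>i\<in>UNIV. h *\<^sub>R (Z $ i $ p i) * (\<Prod>j\<in>UNIV - {i}. V t $ j $ p j)))) (at t)"
    unfolding det_def
    by (intro has_derivative_sum has_derivative_mult_right has_derivative_prod comp)
  moreover have "(\<Sum>p\<in>?P. of_int (sign p) *
      (\<Sum>i\<in>UNIV. h *\<^sub>R (Z $ i $ p i) * (\<Prod>j\<in>UNIV - {i}. V t $ j $ p j))) = h *\<^sub>R trace Z" for h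
  proof -
    have "(\<Sum>p\<in>?P. of_int (sign p) *
      (\<Sum>i\<in>UNIV. h *\<^sub>R (Z $ i $ p i) * (\<Prod>j\<in>UNIV - {i}. V t $ j $ p j)))
      = (\<Sum>p\<in>{id}. of_int (sign p) *
      (\<Sum>i\<in>UNIV. h *\<^sub>R (Z $ i $ p i) * (\<Prod>j\<in>UNIV - {i}. V t $ j $ p j)))"
    proof (rule sum.mono_neutral_right)
      show "\<forall>p\<in>?P - {id}. of_int (sign p) *
        (\<Sum>i\<in>UNIV. h *\<^sub>R (Z $ i $ p i) * (\<Prod>j\<in>UNIV - {i}. V t $ j $ p j)) = 0"
      proof
        fix p assume p: "p \<in> ?P - {id}"
        then have inj: "inj p" by (auto simp: permutes_inj)
        from p obtain a where a: "p a \<noteq> a" by (auto simp: fun_eq_iff)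
        \<comment> \<open>a permutation other than the identity moves at least two indices\<close>
        have "(\<Prod>j\<in>UNIV - {i}. V t $ j $ p j) = 0" for i
        proof (cases "i = a")
          case False
          then show ?thesis using a by (intro prod_zero) (auto simp: 1 mat_def intro!: bexI[of _ a])
        next
          case True
          have "p (p a) \<noteq> p a" using a inj by (simp add: inj_eq)
          then show ?thesis using a True
            by (intro prod_zero) (auto simp: 1 mat_def intro!: bexI[of _ "p a"])
        qed
        then show "of_int (sign p) *
          (\<Sum>i\<in>UNIV. h *\<^sub>R (Z $ i $ p i) * (\<Prod>j\<in>UNIV - {i}. V t $ j $ p j)) = 0"
          by (simp only: mult_zero_right sum.neutral_const)
      qed
    qed (auto simp: permutes_id)
    also have "\<dots> = h *\<^sub>R trace Z"
      by (simp add: 1 mat_def trace_def scaleR_sum_right)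
    finally show ?thesis .
  qed
  ultimately show ?thesis by (simp add: has_vector_derivative_def)
qed

lemma has_vector_derivative_zero_imp_const:
  fixes f :: "real \<Rightarrow> 'a::real_normed_vector"
  assumes "\<And>t. (f has_vector_derivative 0) (at t)"
  shows "f s = f t"
  using has_vector_derivative_zero_constant[of UNIV f] assms
  by (metis UNIV_I convex_UNIV)

text \<open>The one criterion by which curves are shown to stay in \<open>SU(n)\<close>. For skew-Hermitian \<open>Z\<close> the
  equation \<open>U' = Z U\<close> makes \<open>U\<^sup>* U\<close> constant. For the determinant, the curve
  \<open>s \<mapsto> U(s) U(t)\<^sup>*\<close> passes through the identity with velocity \<open>Z\<close>, so Jacobi's formula is
  needed there only, and the trace of \<open>Z\<close> vanishes.\<close>

lemma SU_if_derivative_in_su: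
  fixes U :: "real \<Rightarrow> complex^'n::finite^'n"
  assumes U: "\<And>t. (U has_vector_derivative Z ** U t) (at t)"
    and 0: "U 0 = mat 1" and Z: "Z \<in> su_matrices"
  shows "U t \<in> SU"
proof -
  have Zc: "ctranspose Z = - Z" and tr: "trace Z = 0" using Z by (simp_all add: su_matrices_def)
  have "((\<lambda>t. ctranspose (U t) ** U t) has_vector_derivative
      ctranspose (U t) ** (Z ** U t) + ctranspose (Z ** U t) ** U t) (at t)" for t
    by (intro has_vector_derivative_matrix_mult has_vector_derivative_ctranspose U)
  then have "((\<lambda>t. ctranspose (U t) ** U t) has_vector_derivative 0) (at t)" for t
    by (simp add: ctranspose_mult Zc matrix_mult_uminus_left matrix_mult_uminus_right matrix_mul_assoc)
  from has_vector_derivative_zero_imp_const[OF this, of _ 0]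
  have uni: "ctranspose (U t) ** U t = mat 1" for t by (simp add: 0)
  then have uni': "U t ** ctranspose (U t) = mat 1" for t by (simp add: matrix_left_right_inverse)
  have "((\<lambda>t. det (U t)) has_vector_derivative 0) (at t)" for t
  proof -
    let ?V = "\<lambda>s. U s ** ctranspose (U t)"
    have "(?V has_vector_derivative Z ** U t ** ctranspose (U t)) (at t)"
      by (rule bounded_linear.has_vector_derivative[OF matrix_mult.bounded_linear_left U])
    then have "(?V has_vector_derivative Z) (at t)"
      by (simp add: matrix_mul_assoc[symmetric] uni')
    from det_has_vector_derivative_at_mat_1[OF this uni']
    have "((\<lambda>s. det (?V s)) has_vector_derivative 0) (at t)" by (simp add: tr)
    then have "((\<lambda>s. det (?V s) * det (U t)) has_vector_derivative 0 * det (U t)) (at t)"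
      by (rule has_vector_derivative_mult_left)
    moreover have "det (?V s) * det (U t) = det (U s)" for s
      by (metis det_mul matrix_mul_assoc matrix_mul_rid uni)
    ultimately show ?thesis by simp
  qed
  from has_vector_derivative_zero_imp_const[OF this, of _ 0]
  have "det (U t) = 1" by (simp add: 0)
  then show ?thesis by (simp add: SU_def uni')
qed

section \<open>The matrix exponential\<close>

lemma matrix_power_mult_scaleR:
  fixes A B :: "complex^'n::finite^'n"
  shows "((**) (t *\<^sub>R A) ^^ k) B = t ^ k *\<^sub>R ((**) A ^^ k) B"
  by (induction k) (simp_all add: matrix_mult.scaleR_left matrix_mult.scaleR_right)

lemma summable_norm_exp_series:
  fixes A :: "complex^'n::finite^'n"
  shows "summable (\<lambda>k. norm (t ^ k *\<^sub>R ((1 / fact k) *\<^sub>R (((**) A ^^ k) (mat 1)))))"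
proof -
  obtain K where K: "K > 0" "\<And>(a :: complex^'n^'n) (b :: complex^'n^'n). norm (a ** b) \<le> norm a * norm b * K"
    using matrix_mult.pos_bounded by blast
  have b: "norm (((**) A ^^ k) (mat 1)) \<le> (norm A * K) ^ k * norm (mat 1 :: complex^'n^'n)" for k
  proof (induction k)
    case (Suc k)
    have "norm (((**) A ^^ Suc k) (mat 1)) \<le> norm A * norm (((**) A ^^ k) (mat 1)) * K"
      using K(2) by simp
    also have "\<dots> \<le> norm A * ((norm A * K) ^ k * norm (mat 1 :: complex^'n^'n)) * K"
      using Suc K(1) by (intro mult_right_mono mult_left_mono) auto
    finally show ?case by (simp add: algebra_simps)
  qed simp
  have "summable (\<lambda>k. (inverse (fact k) * (\<bar>t\<bar> * (norm A * K)) ^ k) * norm (mat 1 :: complex^'n^'n))"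
    by (intro summable_mult2 summable_exp)
  then show ?thesis
  proof (rule summable_comparison_test'[where N = 0])
    fix k :: nat
    have "norm (t ^ k *\<^sub>R ((1 / fact k) *\<^sub>R (((**) A ^^ k) (mat 1 :: complex^'n^'n))))
      = \<bar>t\<bar> ^ k * inverse (fact k) * norm (((**) A ^^ k) (mat 1))"
      by (simp add: power_abs divide_inverse abs_mult)
    also have "\<dots> \<le> \<bar>t\<bar> ^ k * inverse (fact k) * ((norm A * K) ^ k * norm (mat 1 :: complex^'n^'n))"
      by (intro mult_left_mono b) simp
    finally show "norm (norm (t ^ k *\<^sub>R ((1 / fact k) *\<^sub>R (((**) A ^^ k) (mat 1 :: complex^'n^'n)))))
      \<le> (inverse (fact k) * (\<bar>t\<bar> * (norm A * K)) ^ k) * norm (mat 1 :: complex^'n^'n)"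
      by (simp add: power_mult_distrib mult_ac)
  qed
qed

lemma mat_exp_nth_sums:
  fixes A :: "complex^'n::finite^'n"
  shows "(\<lambda>k. (((**) A ^^ k) (mat 1)) $ i $ j / fact k * of_real t ^ k) sums mat_exp (t *\<^sub>R A) $ i $ j"
proof -
  have "summable (\<lambda>k. t ^ k *\<^sub>R ((1 / fact k) *\<^sub>R (((**) A ^^ k) (mat 1))))"
    by (rule summable_norm_cancel[OF summable_norm_exp_series])
  then have "(\<lambda>k. (1 / fact k) *\<^sub>R (((**) (t *\<^sub>R A) ^^ k) (mat 1))) sums mat_exp (t *\<^sub>R A)"
    unfolding mat_exp_def by (intro summable_sums) (simp add: matrix_power_mult_scaleR mult.commute)
  from bounded_linear.sums[OF bounded_linear_vec_nth
      bounded_linear.sums[OF bounded_linear_vec_nth this]]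
  have "(\<lambda>k. ((1 / fact k) *\<^sub>R (((**) (t *\<^sub>R A) ^^ k) (mat 1))) $ i $ j)
    sums mat_exp (t *\<^sub>R A) $ i $ j" .
  then show ?thesis
    by (simp add: matrix_power_mult_scaleR) (simp add: scaleR_conv_of_real[where 'a = complex] mult_ac)
qed

lemma mat_exp_0: "mat_exp (0 *\<^sub>R (A :: complex^'n::finite^'n)) = mat 1"
proof -
  have "mat_exp (0 *\<^sub>R A) $ i $ j = mat 1 $ i $ j" for i j
  proof -
    have "(\<lambda>k. (((**) A ^^ k) (mat 1)) $ i $ j / fact k * of_real 0 ^ k) sums
        ((((**) A ^^ 0) (mat 1)) $ i $ j / fact 0)"
      using powser_sums_zero[of "\<lambda>k. (((**) A ^^ k) (mat 1)) $ i $ j / fact k :: complex"] by simp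
    from sums_unique2[OF mat_exp_nth_sums[of A i j 0] this] show ?thesis by simp
  qed
  then show ?thesis by (simp add: vec_eq_iff)
qed

text \<open>Each entry of \<open>exp (t A)\<close> is an everywhere convergent power series in \<open>t\<close>. Its formal
  derivative has the coefficients \<open>(A\<^sup>k\<^sup>+\<^sup>1)\<^sub>i\<^sub>j / k!\<close>, and splitting off the first factor \<open>A\<close>
  of the power turns it into row \<open>i\<close> of \<open>A\<close> times column \<open>j\<close> of \<open>exp (t A)\<close>.\<close>

lemma mat_exp_has_vector_derivative:
  fixes A :: "complex^'n::finite^'n"
  shows "((\<lambda>t. mat_exp (t *\<^sub>R A)) has_vector_derivative A ** mat_exp (t *\<^sub>R A)) (at t)"
proof (rule has_vector_derivative_matrixI)
  fix i j
  \<comment> \<open>only the row index varies below, the column \<open>j\<close> is fixed\<close>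
  define c where "c = (\<lambda>i k. (((**) A ^^ k) (mat 1)) $ i $ j / fact k :: complex)"
  define f where "f = (\<lambda>i z. \<Sum>k. c i k * z ^ k)"
  have sums: "(\<lambda>k. c i k * of_real t ^ k) sums mat_exp (t *\<^sub>R A) $ i $ j" for i t
    unfolding c_def by (rule mat_exp_nth_sums)
  then have f: "mat_exp (t *\<^sub>R A) $ i $ j = f i (of_real t)" for i t
    unfolding f_def by (simp add: sums_iff)
  have summ: "summable (\<lambda>k. c i k * z ^ k)" for i z
  proof (rule powser_inside)
    show "summable (\<lambda>k. c i k * of_real (norm z + 1) ^ k)"
      using sums[of i "norm z + 1"] by (simp add: sums_iff del: of_real_add)
    have "norm (of_real (norm z + 1) :: complex) = norm z + 1"
      by (simp only: norm_of_real) simp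
    then show "norm z < norm (of_real (norm z + 1) :: complex)" by linarith
  qed
  have diffs: "diffs (c i) k = (\<Sum>l\<in>UNIV. A $ i $ l * c l k)" for k
    unfolding diffs_def c_def
    by (simp add: matrix_matrix_mult_def[of A] sum_divide_distrib sum_distrib_left field_simps
        del: of_nat_Suc)
  have "((f i) has_field_derivative (\<Sum>k. diffs (c i) k * (of_real t) ^ k)) (at (of_real t))"
    unfolding f_def
    by (rule termdiffs[where K = "of_real (\<bar>t\<bar> + 1)"]) (intro termdiff_converges_all summ, auto simp: summ termdiff_converges_all simp del: of_real_add)
  moreover have "(\<Sum>k. diffs (c i) k * (of_real t) ^ k) = (\<Sum>l\<in>UNIV. A $ i $ l * f l (of_real t))"
  proof -
    have "(\<lambda>k. \<Sum>l\<in>UNIV. A $ i $ l * (c l k * of_real t ^ k)) sums (\<Sum>l\<in>UNIV. A $ i $ l * f l (of_real t))"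
      unfolding f_def by (intro sums_sum sums_mult summable_sums summ)
    then show ?thesis by (simp add: sums_iff diffs sum_distrib_right mult.assoc)
  qed
  ultimately have DER: "((f i) has_field_derivative (A ** mat_exp (t *\<^sub>R A)) $ i $ j) (at (of_real t))"
    by (simp add: f matrix_matrix_mult_def)
  have "(complex_of_real has_vector_derivative 1) (at t)"
    using has_vector_derivative_of_real[OF DERIV_ident, of "at t"] by simp
  from field_vector_diff_chain_at[OF this DER]
  show "((\<lambda>t. mat_exp (t *\<^sub>R A) $ i $ j) has_vector_derivative (A ** mat_exp (t *\<^sub>R A)) $ i $ j) (at t)"
    by (simp add: f o_def)
qed

lemma mat_exp_in_SU:
  fixes A :: "complex^'n::finite^'n"
  assumes "A \<in> su_matrices"
  shows "mat_exp (t *\<^sub>R A) \<in> SU"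
  using SU_if_derivative_in_su[OF mat_exp_has_vector_derivative mat_exp_0 assms] .

lemma diag_mult_nth:
  fixes A :: "complex^'n::finite^'n"
  shows "(diag x ** A) $ i $ j = x $ i * A $ i $ j" "(A ** diag x) $ i $ j = A $ i $ j * x $ j"
  by (simp_all add: matrix_matrix_mult_def diag_def if_distrib if_distribR sum.delta' cong: if_cong)

lemma mat_exp_diag:
  fixes x :: "complex^'n::finite"
  shows "mat_exp (t *\<^sub>R diag x) = diag (\<chi> i. exp (of_real t * x $ i))"
proof -
  have "mat_exp (t *\<^sub>R diag x) $ i $ j = diag (\<chi> i. exp (of_real t * x $ i)) $ i $ j" for i j
  proof -
    have p: "(((**) (diag x) ^^ k) (mat 1)) $ i $ j = (if i = j then x $ i ^ k else 0)" for k
      by (induction k arbitrary: i) (auto simp: mat_def diag_mult_nth)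
    have "(\<lambda>k. (((**) (diag x) ^^ k) (mat 1)) $ i $ j / fact k * of_real t ^ k) sums
        diag (\<chi> i. exp (of_real t * x $ i)) $ i $ j"
      unfolding p using exp_converges[of "of_real t * x $ i"]
      by (auto simp: diag_def power_mult_distrib scaleR_conv_of_real field_simps)
    from sums_unique2[OF mat_exp_nth_sums this] show ?thesis .
  qed
  then show ?thesis by (simp add: vec_eq_iff)
qed

lemma mat_exp_diag_add:
  fixes x :: "complex^'n::finite"
  shows "mat_exp ((s + t) *\<^sub>R diag x) = mat_exp (s *\<^sub>R diag x) ** mat_exp (t *\<^sub>R diag x)"
  unfolding mat_exp_diag
  by (simp add: vec_eq_iff diag_mult_nth) (simp add: diag_def distrib_right exp_add)

lemma mat_exp_diag_1:
  fixes x :: "complex^'n::finite"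
  assumes "\<forall>j. \<exists>k::int. x $ j = 2 * of_real pi * \<i> * of_int k"
  shows "mat_exp (1 *\<^sub>R diag x) = mat 1"
proof -
  have "exp (x $ j) = 1" for j
  proof -
    obtain k :: int where "x $ j = (2 * of_int k * pi) * \<i>"
      using assms[rule_format, of j] by (auto simp: mult_ac)
    then show ?thesis using exp_integer_2pi[of "of_int k"] by simp
  qed
  then show ?thesis unfolding mat_exp_diag by (simp add: vec_eq_iff diag_def mat_def)
qed

text \<open>The hypothesis says that \<open>g\<^sub>i\<^sub>j\<close> is nonzero only where \<open>x\<^sub>j = y\<^sub>i\<close>; this condition passes from
  the diagonal entries to their exponentials.\<close>

lemma intertwines_mat_exp_diag:
  fixes g :: "complex^'n::finite^'n"
  assumes "g ** diag x = diag y ** g"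
  shows "g ** mat_exp (t *\<^sub>R diag x) = mat_exp (t *\<^sub>R diag y) ** g"
proof -
  have "g $ i $ j = 0 \<or> x $ j = y $ i" for i j
    using arg_cong[OF assms, of "\<lambda>A. A $ i $ j"] by (auto simp: diag_mult_nth)
  then have "g $ i $ j * exp (of_real t * x $ j) = exp (of_real t * y $ i) * g $ i $ j" for i j
    by (metis mult.commute mult_zero_left)
  then show ?thesis unfolding mat_exp_diag by (simp add: vec_eq_iff diag_mult_nth)
qed

section \<open>Paths to permutation matrices\<close>

text \<open>For \<open>a \<noteq> b\<close> this is the rotation by \<open>\<theta>\<close> in the coordinate plane of \<open>a\<close> and \<open>b\<close>.\<close>

definition rotation :: "'n::finite \<Rightarrow> 'n \<Rightarrow> real \<Rightarrow> complex^'n^'n" where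
  "rotation a b \<theta> = (\<chi> i j.
     if i = a \<and> j = a \<or> i = b \<and> j = b then of_real (cos \<theta>)
     else if i = a \<and> j = b then of_real (sin \<theta>)
     else if i = b \<and> j = a then - of_real (sin \<theta>)
     else if i = j then 1 else 0)"

definition rotation_generator :: "'n::finite \<Rightarrow> 'n \<Rightarrow> complex^'n^'n" where
  "rotation_generator a b = (\<chi> i j. if i = a \<and> j = b then 1 else if i = b \<and> j = a then - 1 else 0)"

lemma rotation_generator_mult_nth:
  fixes A :: "complex^'n::finite^'n"
  assumes "a \<noteq> b"
  shows "(rotation_generator a b ** A) $ i $ j = (if i = a then A $ b $ j else if i = b then - A $ a $ j else 0)"
proof -
  have "rotation_generator a b $ i $ l * A $ l $ j =
      (if l = b then if i = a then A $ l $ j else 0 else 0) +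
      (if l = a then if i = b then - A $ l $ j else 0 else 0)" for l
    using assms by (simp add: rotation_generator_def)
  then show ?thesis using assms
    by (simp add: matrix_matrix_mult_def sum.distrib)
qed

lemma rotation_has_vector_derivative:
  assumes "a \<noteq> b"
  shows "(rotation a b has_vector_derivative rotation_generator a b ** rotation a b \<theta>) (at \<theta>)"
proof (rule has_vector_derivative_matrixI)
  fix i j
  have c: "((\<lambda>t. of_real (cos t) :: complex) has_vector_derivative - of_real (sin \<theta>)) (at \<theta>)"
    and s: "((\<lambda>t. of_real (sin t) :: complex) has_vector_derivative of_real (cos \<theta>)) (at \<theta>)"
    by (auto intro!: derivative_eq_intros has_vector_derivative_of_real simp: has_real_derivative_iff_has_vector_derivative[symmetric])
  note ms = has_vector_derivative_minus[OF s]
  show "((\<lambda>t. rotation a b t $ i $ j) has_vector_derivative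
      (rotation_generator a b ** rotation a b \<theta>) $ i $ j) (at \<theta>)"
    using assms c s ms unfolding rotation_generator_mult_nth[OF assms]
    by (cases "i = a"; cases "i = b"; cases "j = a"; cases "j = b") (simp_all add: rotation_def)
qed

lemma rotation_0: "rotation a b 0 = mat 1"
proof -
  have "rotation a b 0 $ i $ j = mat 1 $ i $ j" for i j
    by (cases "i = a"; cases "i = b"; cases "j = a"; cases "j = b") (simp_all add: rotation_def mat_def)
  then show ?thesis by (simp add: vec_eq_iff)
qed

lemma rotation_in_SU:
  assumes "a \<noteq> b"
  shows "rotation a b \<theta> \<in> SU"
proof (rule SU_if_derivative_in_su[OF rotation_has_vector_derivative[OF assms]])
  show "rotation a b 0 = mat 1" by (rule rotation_0)
  show "rotation_generator a b \<in> su_matrices"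
    using assms by (auto simp: su_matrices_def vec_eq_iff rotation_generator_def trace_def intro!: sum.neutral)
qed

text \<open>A quarter turn is the matrix of the transposition up to one sign, and conjugation of a
  diagonal matrix does not see signs. The signed matrix is used because the unsigned one has
  determinant \<open>- 1\<close>.\<close>

lemma rotation_transposes:
  assumes "a \<noteq> b"
  shows "rotation a b (pi / 2) ** diag x = diag (\<chi> j. x $ Transposition.transpose a b j) ** rotation a b (pi / 2)"
proof -
  have "rotation a b (pi / 2) $ i $ j * x $ j =
      x $ Transposition.transpose a b i * rotation a b (pi / 2) $ i $ j" for i j
    using assms
    by (cases "i = a"; cases "i = b"; cases "j = a"; cases "j = b")
      (simp_all add: rotation_def Transposition.transpose_def)
  then show ?thesis by (simp add: vec_eq_iff diag_mult_nth)
qed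

text \<open>Writing \<open>\<tau>\<close> as a product of transpositions, one multiplies the corresponding paths of
  rotations pointwise. Products of paths from the identity again start at the identity, so this
  takes the place of concatenation. The equation at the endpoint is stated as an intertwining
  relation because such relations compose by associativity alone.\<close>

lemma SU_path_to_permutation:
  fixes x :: "complex^'n::finite"
  assumes "\<tau> permutes (UNIV :: 'n set)"
  shows "\<exists>g :: real \<Rightarrow> complex^'n^'n. continuous_on UNIV g \<and> (\<forall>s. g s \<in> SU) \<and> g 0 = mat 1 \<and>
     g 1 ** diag x = diag (\<chi> j. x $ \<tau> j) ** g 1"
  using assms finite_class.finite_UNIV
proof (induction arbitrary: x rule: permutes_induct)
  case id
  show ?case by (rule exI[of _ "\<lambda>_. mat 1"]) (auto simp: vec_eq_iff)
next
  case (swap a b p)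
  let ?y = "\<chi> j. x $ Transposition.transpose a b j"
  obtain h :: "real \<Rightarrow> complex^'n^'n" where h: "continuous_on UNIV h" "\<And>s. h s \<in> SU" "h 0 = mat 1"
    "h 1 ** diag ?y = diag (\<chi> j. ?y $ p j) ** h 1"
    using swap.IH[of ?y] by blast
  let ?r = "\<lambda>s. rotation a b (s * (pi / 2))"
  have cont: "continuous_on UNIV (rotation a b)"
    using has_vector_derivative_continuous[OF rotation_has_vector_derivative[OF \<open>a \<noteq> b\<close>]]
    by (simp add: continuous_on_eq_continuous_at)
  show ?case
  proof (intro exI conjI allI)
    show "continuous_on UNIV (\<lambda>s. h s ** ?r s)"
      by (intro matrix_mult.continuous_on h continuous_on_compose2[OF cont] continuous_intros) auto
    show "h s ** ?r s \<in> SU" for s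
      by (intro SU_mult h rotation_in_SU swap)
    show "h 0 ** ?r 0 = mat 1"
      by (simp add: h(3) rotation_0)
    have "h 1 ** ?r 1 ** diag x = (h 1 ** diag ?y) ** ?r 1"
      using rotation_transposes[OF \<open>a \<noteq> b\<close>, of x] by (simp add: matrix_mul_assoc[symmetric])
    then show "h 1 ** ?r 1 ** diag x = diag (\<chi> j. x $ (Transposition.transpose a b \<circ> p) j) ** (h 1 ** ?r 1)"
      by (simp add: h(4) matrix_mul_assoc)
  qed
qed

section \<open>Coordinates on the dual of the Lie algebra\<close>

lemma bounded_linear_Rep_su: "bounded_linear Rep_su"
  by (rule bounded_linear_intro[where K = 1]) (simp_all add: plus_su.rep_eq scaleR_su.rep_eq norm_su.rep_eq)

text \<open>An arbitrarily chosen linear left inverse of the inclusion into the matrix space. It turns the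
  standard basis of the matrix space into a spanning family of the Lie algebra.\<close>

definition su_proj :: "complex^'n::finite^'n \<Rightarrow> 'n su" where
  "su_proj = (SOME P. bounded_linear P \<and> (\<forall>Z. P (Rep_su Z) = Z))"

lemma su_proj:
  fixes Z :: "'n::finite su"
  shows "bounded_linear (su_proj :: complex^'n^'n \<Rightarrow> 'n su)" "su_proj (Rep_su Z) = Z"
proof -
  have "linear (Rep_su :: 'n su \<Rightarrow> _)" by (rule bounded_linear.linear[OF bounded_linear_Rep_su])
  moreover have "inj (Rep_su :: 'n su \<Rightarrow> _)" by (simp add: inj_on_def Rep_su_inject)
  ultimately obtain P :: "complex^'n^'n \<Rightarrow> 'n su" where "linear P" "P \<circ> Rep_su = id"
    using real_vector.linear_injective_left_inverse by blast
  then have "\<exists>P. bounded_linear P \<and> (\<forall>Z :: 'n su. P (Rep_su Z) = Z)"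
    by (auto simp: linear_conv_bounded_linear fun_eq_iff)
  then have "bounded_linear (su_proj :: complex^'n^'n \<Rightarrow> 'n su) \<and> (\<forall>Z :: 'n su. su_proj (Rep_su Z) = Z)"
    unfolding su_proj_def by (rule someI_ex)
  then show "bounded_linear (su_proj :: complex^'n^'n \<Rightarrow> 'n su)" "su_proj (Rep_su Z) = Z" by auto
qed

lemma bounded_linear_inner_Rep_su: "bounded_linear (\<lambda>Z. Rep_su Z \<bullet> b)"
  by (rule bounded_linear_compose[OF bounded_linear_inner_left bounded_linear_Rep_su])

definition dual_vec :: "complex^'n::finite^'n \<Rightarrow> 'n su_dual" where
  "dual_vec b = Blinfun (\<lambda>Z. Rep_su Z \<bullet> b)"

lemma dual_vec_apply: "blinfun_apply (dual_vec b) Z = Rep_su Z \<bullet> b"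
  by (simp add: dual_vec_def bounded_linear_Blinfun_apply bounded_linear_inner_Rep_su)

definition coord :: "complex^'n::finite^'n \<Rightarrow> 'n su_dual \<Rightarrow> real" where
  "coord b \<nu> = blinfun_apply \<nu> (su_proj b)"

lemma bounded_linear_coord: "bounded_linear (coord b)"
  unfolding coord_def by (rule blinfun.bounded_linear_left)

text \<open>The functionals \<open>dual_vec b\<close> are more than a basis of the dual space, as they are indexed by
  the basis of all matrices, but every functional is a combination of them with coefficients that
  depend linearly on it. This reduces statements about all \<open>\<nu>\<close>, and statements about the norm
  of the dual space, to finitely many real-valued functions.\<close>

lemma su_dual_expansion: "(\<Sum>b\<in>Basis. coord b \<nu> *\<^sub>R dual_vec b) = \<nu>"
proof (rule blinfun_eqI)
  fix Z
  have "blinfun_apply (\<Sum>b\<in>Basis. coord b \<nu> *\<^sub>R dual_vec b) Z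
      = (\<Sum>b\<in>Basis. (Rep_su Z \<bullet> b) *\<^sub>R blinfun_apply \<nu> (su_proj b))"
    by (simp add: blinfun.sum_left blinfun.scaleR_left dual_vec_apply coord_def mult.commute)
  also have "\<dots> = blinfun_apply \<nu> (su_proj (\<Sum>b\<in>Basis. (Rep_su Z \<bullet> b) *\<^sub>R b))"
    by (simp add: linear_sum[OF bounded_linear.linear[OF su_proj(1)]]
        linear_cmul[OF bounded_linear.linear[OF su_proj(1)]] blinfun.sum_right blinfun.scaleR_right)
  also have "\<dots> = blinfun_apply \<nu> Z" by (simp add: euclidean_representation su_proj(2))
  finally show "blinfun_apply (\<Sum>b\<in>Basis. coord b \<nu> *\<^sub>R dual_vec b) Z = blinfun_apply \<nu> Z" .
qed

lemma bounded_linear_apply_expansion: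
  assumes "bounded_linear (L :: 'n::finite su_dual \<Rightarrow> 'a::real_normed_vector)"
  shows "L \<nu> = (\<Sum>b\<in>Basis. coord b \<nu> *\<^sub>R L (dual_vec b))"
proof -
  interpret L: bounded_linear L by fact
  show ?thesis by (subst su_dual_expansion[symmetric]) (simp add: L.sum L.scaleR)
qed

section \<open>The coadjoint action\<close>

lemma Rep_su_props: "ctranspose (Rep_su Z) = - Rep_su Z" "trace (Rep_su Z) = 0"
  using Rep_su[of Z] by (simp_all add: su_matrices_def)

lemma Ad_matrix_inv:
  assumes "g \<in> SU"
  shows "Ad (matrix_inv g) Z = su_proj (ctranspose g ** Rep_su Z ** g)"
proof -
  have "Rep_su (Ad (matrix_inv g) Z) = ctranspose g ** Rep_su Z ** g"
    using assms by (simp add: Rep_su_Ad SU_matrix_inv SU_inverse SU_ctranspose)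
  then show ?thesis by (metis su_proj(2))
qed

lemma Ad_mult:
  assumes "g \<in> SU" "h \<in> SU"
  shows "Ad (g ** h) Z = Ad g (Ad h Z)"
  by (simp add: Rep_su_inject[symmetric] Rep_su_Ad assms SU_mult SU_inverse ctranspose_mult matrix_mul_assoc)

lemma coAd_mult:
  assumes "g \<in> SU" "h \<in> SU"
  shows "coAd (g ** h) \<nu> = coAd g (coAd h \<nu>)"
  by (rule blinfun_eqI)
    (simp add: coAd_apply assms SU_mult SU_inverse ctranspose_mult Ad_mult SU_ctranspose)

lemma coAd_mat_1: "coAd (mat 1) \<nu> = \<nu>"
  by (rule blinfun_eqI) (simp add: coAd_apply Ad_matrix_inv su_proj(2))

text \<open>The dependence on \<open>g\<close> becomes explicit: \<open>g\<close> occurs only in the argument of \<open>\<nu>\<close>, as a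
  quadratic expression. Continuity and differentiability in \<open>g\<close> are read off from here.\<close>

lemma coAd_expansion:
  assumes "g \<in> SU"
  shows "coAd g \<nu> = (\<Sum>b\<in>Basis.
    blinfun_apply \<nu> (su_proj (ctranspose g ** Rep_su (su_proj b) ** g)) *\<^sub>R dual_vec b)"
  by (subst su_dual_expansion[symmetric]) (simp add: coord_def coAd_apply assms Ad_matrix_inv)

lemma bounded_linear_coAd:
  assumes "g \<in> SU"
  shows "bounded_linear (coAd g)"
  unfolding coAd_expansion[OF assms, abs_def]
  by (intro bounded_linear_sum bounded_linear_compose[OF bounded_linear_scaleR_left] blinfun.bounded_linear_left)

lemma bounded_linear_coad: "bounded_linear (coad Y)"
proof -
  have "coad Y = (\<lambda>\<nu>. \<Sum>b\<in>Basis. - blinfun_apply \<nu> (bracket Y (su_proj b)) *\<^sub>R dual_vec b)"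
    by (rule ext, subst su_dual_expansion[symmetric]) (simp add: coord_def coad_apply)
  moreover have "bounded_linear (\<lambda>\<nu>. \<Sum>b\<in>Basis. - blinfun_apply \<nu> (bracket Y (su_proj b)) *\<^sub>R dual_vec b)"
    by (intro bounded_linear_sum bounded_linear_compose[OF bounded_linear_scaleR_left]
      bounded_linear_minus blinfun.bounded_linear_left)
  ultimately show ?thesis by (simp only:)
qed

text \<open>By the product rule, \<open>g\<^sup>* C g\<close> has derivative \<open>C Y - Y C\<close> where \<open>g\<close> is the identity, because
  \<open>Y\<^sup>* = - Y\<close>. Through the expansion in coordinates this derivative becomes that of the action, and its
  sign is the one in the definition of \<open>coad\<close>.\<close>

lemma coAd_has_vector_derivative:
  assumes g: "(g has_vector_derivative Rep_su Y) (at t)" and 1: "g t = mat 1" and SU: "\<And>t. g t \<in> SU"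
  shows "((\<lambda>t. coAd (g t) \<nu>) has_vector_derivative coad Y \<nu>) (at t)"
proof -
  have "((\<lambda>t. \<Sum>b\<in>Basis. coord b (coAd (g t) \<nu>) *\<^sub>R dual_vec b)
    has_vector_derivative (\<Sum>b\<in>Basis. coord b (coad Y \<nu>) *\<^sub>R dual_vec b)) (at t)"
  proof (intro has_vector_derivative_sum)
    fix b :: "complex^'a^'a"
    let ?C = "Rep_su (su_proj b)"
    have "((\<lambda>t. ctranspose (g t) ** ?C ** g t) has_vector_derivative
        (ctranspose (g t) ** ?C ** Rep_su Y + ctranspose (Rep_su Y) ** ?C ** g t)) (at t)"
      by (intro has_vector_derivative_matrix_mult g
          bounded_linear.has_vector_derivative[OF matrix_mult.bounded_linear_left]
          has_vector_derivative_ctranspose)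
    moreover have "ctranspose (g t) ** ?C ** Rep_su Y + ctranspose (Rep_su Y) ** ?C ** g t
      = - Rep_su (bracket Y (su_proj b))"
      by (simp add: 1 Rep_su_props bracket.rep_eq matrix_mult_uminus_left)
    ultimately have "((\<lambda>t. ctranspose (g t) ** ?C ** g t) has_vector_derivative
        - Rep_su (bracket Y (su_proj b))) (at t)" by simp
    from bounded_linear.has_vector_derivative[OF blinfun.bounded_linear_right
       bounded_linear.has_vector_derivative[OF su_proj(1) this], of \<nu>]
    have "((\<lambda>t. coord b (coAd (g t) \<nu>)) has_vector_derivative coord b (coad Y \<nu>)) (at t)"
      by (simp add: coord_def coAd_apply SU Ad_matrix_inv coad_apply su_proj(2)
         linear_neg[OF bounded_linear.linear[OF su_proj(1)]] blinfun.minus_right)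
    from bounded_linear.has_vector_derivative[OF bounded_linear_scaleR_left this]
    show "((\<lambda>t. coord b (coAd (g t) \<nu>) *\<^sub>R dual_vec b)
      has_vector_derivative coord b (coad Y \<nu>) *\<^sub>R dual_vec b) (at t)" .
  qed
  then show ?thesis by (simp only: su_dual_expansion)
qed

lemma continuous_on_coAd: "continuous_on SU (\<lambda>g. coAd g \<nu>)"
proof -
  have "continuous_on SU (\<lambda>g. \<Sum>b\<in>Basis.
    blinfun_apply \<nu> (su_proj (ctranspose g ** Rep_su (su_proj b) ** g)) *\<^sub>R dual_vec b)"
    by (intro continuous_intros matrix_mult.continuous_on bounded_linear.continuous_on[OF su_proj(1)])
  then show ?thesis by (subst continuous_on_cong[OF refl coAd_expansion]) auto
qed

text \<open>The operator norm of \<open>coAd g - coAd h\<close> is small for \<open>g\<close> near \<open>h\<close>. The bound \<open>K g h\<close> sums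
  the changes of the finitely many coefficients in the expansion of \<open>coAd g \<nu>\<close>.\<close>

lemma coAd_diff_bound:
  obtains K :: "complex^'n::finite^'n \<Rightarrow> complex^'n^'n \<Rightarrow> real"
  where "\<And>g h \<nu>. g \<in> SU \<Longrightarrow> h \<in> SU \<Longrightarrow> norm (coAd g \<nu> - coAd h \<nu>) \<le> K g h * norm \<nu>"
    "\<And>h. continuous_on UNIV (\<lambda>g. K g h)" "\<And>h. K h h = 0" "\<And>g h. K g h \<ge> 0"
proof
  define q :: "complex^'n::finite^'n \<Rightarrow> complex^'n^'n \<Rightarrow> 'n su"
    where "q = (\<lambda>b g. su_proj (ctranspose g ** Rep_su (su_proj b) ** g))"
  let ?K = "\<lambda>g h. \<Sum>b\<in>Basis. norm (q b g - q b h) * norm (dual_vec b :: 'n su_dual)"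
  show "norm (coAd g \<nu> - coAd h \<nu>) \<le> ?K g h * norm \<nu>" if "g \<in> SU" "h \<in> SU" for g h \<nu>
  proof -
    have "coAd g \<nu> - coAd h \<nu> = (\<Sum>b\<in>Basis. blinfun_apply \<nu> (q b g - q b h) *\<^sub>R dual_vec b)"
      by (simp add: coAd_expansion[OF that(1)] coAd_expansion[OF that(2)] q_def blinfun.diff_right
          scaleR_diff_left sum_subtractf)
    also have "norm \<dots> \<le> (\<Sum>b\<in>Basis. norm \<nu> * norm (q b g - q b h) * norm (dual_vec b :: 'n su_dual))"
      by (intro sum_norm_le) (simp add: mult_right_mono norm_blinfun[of \<nu>, unfolded real_norm_def])
    also have "\<dots> = ?K g h * norm \<nu>" by (simp add: sum_distrib_left sum_distrib_right mult_ac)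
    finally show ?thesis .
  qed
  show "continuous_on UNIV (\<lambda>g. ?K g h)" for h
    unfolding q_def
    by (intro continuous_intros matrix_mult.continuous_on bounded_linear.continuous_on[OF su_proj(1)])
qed (auto intro!: sum_nonneg)

section \<open>Coadjoint orbits\<close>

text \<open>Compactness of the orbit turns a pointwise strict bound on a continuous function into a
  uniform one with room to spare, which is what the \<open>C\<^sup>\<infinity>\<close> topology asks for.\<close>

lemma compact_SU: "compact (SU :: (complex^'n::finite^'n) set)"
proof -
  have cont: "continuous_on UNIV (\<lambda>g :: complex^'n^'n. det g)"
    unfolding det_def by (intro continuous_intros)
  have "closed {g :: complex^'n^'n. g ** ctranspose g = mat 1}" "closed {g :: complex^'n^'n. det g = 1}"
    by (intro closed_Collect_eq cont matrix_mult.continuous_on continuous_intros)+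
  then have "closed (SU :: (complex^'n^'n) set)"
    unfolding SU_def Collect_conj_eq by (rule closed_Int)
  moreover have "bounded (SU :: (complex^'n^'n) set)"
  proof (rule boundedI)
    fix g :: "complex^'n^'n" assume g: "g \<in> SU"
    have entry: "norm (g $ i $ j) \<le> 1" for i j
    proof -
      have "(\<Sum>k\<in>UNIV. g $ i $ k * cnj (g $ i $ k)) = 1"
        using arg_cong[OF SU_D(1)[OF g], of "\<lambda>A. A $ i $ i"] by (simp add: matrix_matrix_mult_def mat_def)
      then have "of_real (\<Sum>k\<in>UNIV. (norm (g $ i $ k))\<^sup>2) = (1 :: complex)"
        by (simp add: complex_norm_square[symmetric])
      then have "(\<Sum>k\<in>UNIV. (norm (g $ i $ k))\<^sup>2) = 1" by (metis of_real_eq_1_iff)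
      moreover have "(norm (g $ i $ j))\<^sup>2 \<le> (\<Sum>k\<in>UNIV. (norm (g $ i $ k))\<^sup>2)"
        by (rule member_le_sum) auto
      ultimately show ?thesis using abs_square_le_1[of "norm (g $ i $ j)"] by simp
    qed
    have "norm g \<le> (\<Sum>i\<in>UNIV. norm (g $ i))" unfolding norm_vec_def by (rule L2_set_le_sum) simp
    also have "\<dots> \<le> (\<Sum>i\<in>UNIV. \<Sum>j\<in>UNIV. norm (g $ i $ j))"
      unfolding norm_vec_def[of "g $ _"] by (intro sum_mono L2_set_le_sum) simp
    also have "\<dots> \<le> (\<Sum>i\<in>(UNIV :: 'n set). \<Sum>j\<in>(UNIV :: 'n set). 1)" by (intro sum_mono entry)
    finally show "norm g \<le> (\<Sum>i\<in>(UNIV :: 'n set). \<Sum>j\<in>(UNIV :: 'n set). 1)" .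
  qed
  ultimately show ?thesis by (simp add: compact_eq_bounded_closed)
qed

lemma compact_coadjoint_orbit: "compact (coadjoint_orbit \<eta>)"
  unfolding coadjoint_orbit_def by (rule compact_continuous_image[OF continuous_on_coAd compact_SU])

lemma coAd_in_coadjoint_orbit:
  assumes "g \<in> SU" "\<nu> \<in> coadjoint_orbit \<eta>"
  shows "coAd g \<nu> \<in> coadjoint_orbit \<eta>"
  using assms unfolding coadjoint_orbit_def by (auto simp: coAd_mult[symmetric] SU_mult)

text \<open>The curve is \<open>t \<mapsto> coAd (exp (t Y)) \<nu>\<close>; that it stays in the orbit uses
  \<open>exp (t Y) \<in> SU(n)\<close> for arbitrary, not only diagonal, \<open>Y\<close>.\<close>

lemma tangent_curve:
  assumes "\<nu> \<in> coadjoint_orbit \<eta>" "w \<in> tangent \<nu>"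
  obtains c :: "real \<Rightarrow> 'n::finite su_dual"
  where "\<And>t. c t \<in> coadjoint_orbit \<eta>" "c 0 = \<nu>" "(c has_vector_derivative w) (at 0)"
proof -
  obtain Y where Y: "w = coad Y \<nu>" using assms(2) by (auto simp: tangent_def)
  let ?g = "\<lambda>t. mat_exp (t *\<^sub>R Rep_su Y)"
  have SU: "?g t \<in> SU" for t by (rule mat_exp_in_SU[OF Rep_su])
  have "(?g has_vector_derivative Rep_su Y) (at 0)"
    using mat_exp_has_vector_derivative[of "Rep_su Y" 0] by (simp only: mat_exp_0 matrix_mul_rid)
  from coAd_has_vector_derivative[OF this mat_exp_0 SU]
  show ?thesis
    by (intro that[of "\<lambda>t. coAd (?g t) \<nu>"])
      (auto simp del: scaleR_zero_left simp: Y mat_exp_0 coAd_mat_1 intro!: coAd_in_coadjoint_orbit SU assms)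
qed

text \<open>A derivative within the orbit is arbitrary in directions transverse to it. On a tangent vector
  it is the derivative of \<open>f\<close> along a curve inside the orbit, which does not depend on the
  choice.\<close>

lemma has_derivative_within_unique_on_tangent:
  assumes D: "(f has_derivative D) (at \<nu> within coadjoint_orbit \<eta>)"
    and D': "(f has_derivative D') (at \<nu> within coadjoint_orbit \<eta>)"
    and \<nu>: "\<nu> \<in> coadjoint_orbit \<eta>" and w: "w \<in> tangent \<nu>"
  shows "D w = D' w"
proof -
  obtain c where c: "\<And>t. c t \<in> coadjoint_orbit \<eta>" "c 0 = \<nu>" "(c has_vector_derivative w) (at 0)"
    using tangent_curve[OF \<nu> w] by blast
  have "((f \<circ> c) has_vector_derivative E w) (at 0)"
    if "(f has_derivative E) (at \<nu> within coadjoint_orbit \<eta>)" for E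
  proof -
    have "(f has_derivative E) (at (c 0) within c ` UNIV)"
      unfolding c(2) by (rule has_derivative_subset[OF that]) (use c(1) in auto)
    then have "((f \<circ> c) has_derivative (E \<circ> (\<lambda>h. h *\<^sub>R w))) (at 0)"
      using diff_chain_within[OF c(3)[unfolded has_vector_derivative_def]] by blast
    moreover have "E \<circ> (\<lambda>h. h *\<^sub>R w) = (\<lambda>h. h *\<^sub>R E w)"
      using linear_cmul[OF has_derivative_linear[OF that]] by (simp add: fun_eq_iff)
    ultimately show ?thesis by (simp add: has_vector_derivative_def)
  qed
  from vector_derivative_unique_at[OF this[OF D] this[OF D']] show ?thesis .
qed

lemma frechet_derivative_on_tangent:
  assumes "(f has_derivative D) (at \<nu> within coadjoint_orbit \<eta>)"
    "\<nu> \<in> coadjoint_orbit \<eta>" "w \<in> tangent \<nu>"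
  shows "frechet_derivative f (at \<nu> within coadjoint_orbit \<eta>) w = D w"
  using has_derivative_within_unique_on_tangent[OF _ assms(1,2,3)]
    assms(1) frechet_derivative_works differentiableI by blast

section \<open>Calculus of smooth maps\<close>

lemma Ck_SucD:
  assumes "Ck (Suc k) U f" "x \<in> U"
  shows "(f has_derivative frechet_derivative f (at x)) (at x)"
  using assms by (simp add: frechet_derivative_works[symmetric])

lemma Ck_cong:
  assumes "open U" "\<And>x. x \<in> U \<Longrightarrow> f x = g x" "Ck k U f"
  shows "Ck k U g"
  using assms(2,3)
proof (induction k arbitrary: f g)
  case 0
  then show ?case by (simp cong: continuous_on_cong)
next
  case (Suc k)
  have fg: "frechet_derivative f (at x) = frechet_derivative g (at x)" if "x \<in> U" for x
    using Suc.prems that by (intro frechet_derivative_transform_within_open[OF _ assms(1)]) auto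
  have "Ck k U (\<lambda>x. frechet_derivative g (at x) v)" for v
    by (rule Suc.IH[where f = "\<lambda>x. frechet_derivative f (at x) v"]) (use Suc.prems fg in auto)
  moreover have "g differentiable (at x)" if "x \<in> U" for x
    by (rule differentiableI,
        rule has_derivative_transform_within_open[OF Ck_SucD[OF Suc.prems(2) that] assms(1) that])
      (rule Suc.prems(1))
  ultimately show ?case by simp
qed

text \<open>The usual way to prove smoothness below: exhibit the derivative in closed form and see
  that its directional values belong to the same class of functions.\<close>

lemma Ck_SucI:
  assumes "open U" and f: "\<And>x. x \<in> U \<Longrightarrow> (f has_derivative f' x) (at x)"
    and f': "\<And>v. Ck k U (\<lambda>x. f' x v)"
  shows "Ck (Suc k) U f"
proof -
  have "Ck k U (\<lambda>x. frechet_derivative f (at x) v)" for v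
    by (rule Ck_cong[OF assms(1) _ f'[of v]]) (simp add: frechet_derivative_at[OF f, symmetric])
  then show ?thesis using f by (auto intro: differentiableI)
qed

lemma Ck_subset: "Ck k U f \<Longrightarrow> V \<subseteq> U \<Longrightarrow> Ck k V f"
  by (induction k arbitrary: f) (auto intro: continuous_on_subset)

lemma Ck_pred: "Ck (Suc k) U f \<Longrightarrow> Ck k U f"
proof (induction k arbitrary: f)
  case 0
  then show ?case
    by (auto intro!: continuous_at_imp_continuous_on differentiable_imp_continuous_within)
qed simp

lemma Ck_const: "open U \<Longrightarrow> Ck k U (\<lambda>x. c)"
proof (induction k arbitrary: c)
  case (Suc k)
  show ?case by (rule Ck_SucI[OF Suc.prems has_derivative_const]) (rule Suc.IH[OF Suc.prems])
qed simp

lemma Ck_bounded_linear: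
  assumes "open U" "bounded_linear L"
  shows "Ck k U L"
proof (cases k)
  case 0
  then show ?thesis using assms linear_continuous_on by auto
next
  case (Suc j)
  show ?thesis unfolding Suc
    by (rule Ck_SucI[OF assms(1) bounded_linear_imp_has_derivative[OF assms(2)]])
      (rule Ck_const[OF assms(1)])
qed

lemma Ck_compose_linear:
  assumes "open U" "bounded_linear L"
  shows "Ck k U f \<Longrightarrow> Ck k U (\<lambda>x. L (f x))"
proof (induction k arbitrary: f)
  case 0
  then show ?case by (simp add: bounded_linear.continuous_on[OF assms(2)])
next
  case (Suc k)
  show ?case
    by (rule Ck_SucI[OF assms(1) bounded_linear.has_derivative[OF assms(2) Ck_SucD[OF Suc.prems]]])
      (use Suc in auto)
qed

lemma Ck_add:
  assumes "open U"
  shows "Ck k U f \<Longrightarrow> Ck k U g \<Longrightarrow> Ck k U (\<lambda>x. f x + g x)"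
proof (induction k arbitrary: f g)
  case 0
  then show ?case by (auto intro: continuous_on_add)
next
  case (Suc k)
  show ?case
    by (rule Ck_SucI[OF assms has_derivative_add[OF Ck_SucD[OF Suc.prems(1)] Ck_SucD[OF Suc.prems(2)]]])
      (use Suc in auto)
qed

lemma Ck_sum:
  assumes "open U" "\<And>b. b \<in> B \<Longrightarrow> Ck k U (f b)"
  shows "Ck k U (\<lambda>x. \<Sum>b\<in>B. f b x)"
  using assms(2)
  by (induction B rule: infinite_finite_induct) (auto intro: Ck_add Ck_const assms(1))

lemma Ck_scaleR:
  fixes f :: "'a::real_normed_vector \<Rightarrow> real"
  assumes "open U"
  shows "Ck k U f \<Longrightarrow> Ck k U g \<Longrightarrow> Ck k U (\<lambda>x. f x *\<^sub>R g x)"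
proof (induction k arbitrary: f g)
  case 0
  then show ?case by (auto intro: continuous_on_scaleR)
next
  case (Suc k)
  show ?case
    by (rule Ck_SucI[OF assms has_derivative_scaleR[OF Ck_SucD[OF Suc.prems(1)] Ck_SucD[OF Suc.prems(2)]]])
      (use Suc in \<open>auto intro!: Ck_add[OF assms] Suc.IH intro: Ck_pred simp del: Ck.simps(2), auto\<close>)
qed

lemma smooth_onI_global:
  assumes "\<And>k. Ck k UNIV F" "\<And>x. x \<in> S \<Longrightarrow> F x = f x"
  shows "smooth_on S f"
  unfolding smooth_on_def using assms by (intro ballI exI[of _ UNIV] exI[of _ F]) auto

lemma smooth_on_cong:
  assumes "smooth_on S f" "\<And>x. x \<in> S \<Longrightarrow> f x = g x"
  shows "smooth_on S g"
  using assms unfolding smooth_on_def by fastforce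

lemma smooth_on_bounded_linear: "bounded_linear L \<Longrightarrow> smooth_on S L"
  by (rule smooth_onI_global[OF Ck_bounded_linear]) auto

lemma has_derivative_within_of_local_extension:
  assumes "(F has_derivative D) (at x)" "open U" "x \<in> U" "x \<in> S" "\<And>y. y \<in> S \<inter> U \<Longrightarrow> F y = f y"
  shows "(f has_derivative D) (at x within S)"
proof (rule has_derivative_transform_eventually[OF has_derivative_at_withinI[OF assms(1)]])
  show "\<forall>\<^sub>F y in at x within S. F y = f y"
    using eventually_at_topological assms(2,3,5) by blast
qed (use assms in auto)

lemma smooth_on_imp_differentiable:
  assumes "smooth_on S f" "x \<in> S"
  shows "f differentiable (at x within S)"
proof -
  obtain U F where UF: "open U" "x \<in> U" "\<And>k. Ck k U F" "\<And>y. y \<in> S \<inter> U \<Longrightarrow> F y = f y"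
    using assms unfolding smooth_on_def by meson
  show ?thesis
    by (rule differentiableI, rule has_derivative_within_of_local_extension[OF Ck_SucD[OF UF(3) UF(2)]])
      (use UF assms in auto)
qed

lemma smooth_on_imp_continuous_on: "smooth_on S f \<Longrightarrow> continuous_on S f"
  unfolding continuous_on_eq_continuous_within
  by (intro ballI differentiable_imp_continuous_within smooth_on_imp_differentiable)

section \<open>Iterated derivatives along vector fields on a coadjoint orbit\<close>

lemma vector_fieldsD:
  assumes "V \<in> vector_fields M"
  shows "smooth_on M V" "\<nu> \<in> M \<Longrightarrow> V \<nu> \<in> tangent \<nu>"
  using assms by (auto simp: vector_fields_def)

text \<open>Near a point, \<open>f\<close> and \<open>V\<close> extend to smooth maps \<open>F\<close> and \<open>W\<close>. Smoothness of \<open>F\<close> concerns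
  derivatives in constant directions only, so \<open>W y\<close> is expanded in the fixed vectors
  \<open>dual_vec b\<close>; the derivative becomes a finite sum of products of smooth functions. Passing from
  \<open>f\<close> to \<open>F\<close> is harmless since \<open>V\<close> is tangent to the orbit.\<close>

lemma smooth_on_directional_derivative:
  fixes f :: "'n::finite su_dual \<Rightarrow> 'b::real_normed_vector"
  assumes f: "smooth_on (coadjoint_orbit \<eta>) f" and V: "V \<in> vector_fields (coadjoint_orbit \<eta>)"
  shows "smooth_on (coadjoint_orbit \<eta>) (\<lambda>\<nu>. frechet_derivative f (at \<nu> within coadjoint_orbit \<eta>) (V \<nu>))"
  unfolding smooth_on_def
proof
  let ?M = "coadjoint_orbit \<eta>"
  fix \<nu> assume \<nu>: "\<nu> \<in> ?M"
  obtain U F where U: "open U" "\<nu> \<in> U" "\<And>k. Ck k U F" "\<And>y. y \<in> ?M \<inter> U \<Longrightarrow> F y = f y"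
    using f \<nu> unfolding smooth_on_def by meson
  obtain T W where T: "open T" "\<nu> \<in> T" "\<And>k. Ck k T W" "\<And>y. y \<in> ?M \<inter> T \<Longrightarrow> W y = V y"
    using vector_fieldsD(1)[OF V] \<nu> unfolding smooth_on_def by meson
  define G where "G = (\<lambda>y. \<Sum>b\<in>Basis. coord b (W y) *\<^sub>R frechet_derivative F (at y) (dual_vec b))"
  have op: "open (U \<inter> T)" using U T by blast
  have F': "Ck k U (\<lambda>y. frechet_derivative F (at y) v)" for k v
    using U(3)[of "Suc k"] by simp
  have "Ck k (U \<inter> T) G" for k
    unfolding G_def
    by (intro Ck_sum Ck_scaleR op Ck_compose_linear[OF op bounded_linear_coord]
        Ck_subset[OF F'] Ck_subset[OF T(3)]) auto
  moreover have "G y = frechet_derivative f (at y within ?M) (V y)" if y: "y \<in> ?M \<inter> (U \<inter> T)" for y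
  proof -
    have D: "(F has_derivative frechet_derivative F (at y)) (at y)"
      using Ck_SucD[OF U(3)] y by blast
    have "frechet_derivative f (at y within ?M) (V y) = frechet_derivative F (at y) (V y)"
      by (rule frechet_derivative_on_tangent[OF
            has_derivative_within_of_local_extension[OF D U(1) _ _ U(4)]])
        (use y vector_fieldsD(2)[OF V] in auto)
    also have "\<dots> = G y"
      using bounded_linear_apply_expansion[OF has_derivative_bounded_linear[OF D], of "W y"] T(4)[of y] y
      by (simp add: G_def)
    finally show ?thesis by simp
  qed
  ultimately show "\<exists>U F. open U \<and> \<nu> \<in> U \<and> (\<forall>k. Ck k U F) \<and>
      (\<forall>y\<in>?M \<inter> U. F y = frechet_derivative f (at y within ?M) (V y))"
    using op U(2) T(2) by (intro exI[of _ "U \<inter> T"] exI[of _ G]) auto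
qed

lemma smooth_on_iter_deriv:
  assumes "smooth_on (coadjoint_orbit \<eta>) f" "set Vs \<subseteq> vector_fields (coadjoint_orbit \<eta>)"
  shows "smooth_on (coadjoint_orbit \<eta>) (iter_deriv (coadjoint_orbit \<eta>) Vs f)"
  using assms by (induction Vs) (auto intro: smooth_on_directional_derivative)

text \<open>The three properties of iterated derivatives that are needed are proved by one induction:
  they are additive, they commute with linear maps applied to the values, and they depend only on
  the values on the orbit.\<close>

lemma iter_deriv_add_linear:
  assumes f: "smooth_on (coadjoint_orbit \<eta>) f" and g: "smooth_on (coadjoint_orbit \<eta>) g"
    and A: "bounded_linear A"
    and h: "\<And>\<mu>. \<mu> \<in> coadjoint_orbit \<eta> \<Longrightarrow> h \<mu> = f \<mu> + A (g \<mu>)"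
    and Vs: "set Vs \<subseteq> vector_fields (coadjoint_orbit \<eta>)" and \<nu>: "\<nu> \<in> coadjoint_orbit \<eta>"
  shows "iter_deriv (coadjoint_orbit \<eta>) Vs h \<nu> =
    iter_deriv (coadjoint_orbit \<eta>) Vs f \<nu> + A (iter_deriv (coadjoint_orbit \<eta>) Vs g \<nu>)"
  using Vs \<nu>
proof (induction Vs arbitrary: \<nu>)
  case Nil
  then show ?case using h by simp
next
  case (Cons V Vs)
  let ?M = "coadjoint_orbit \<eta>"
  let ?D = "\<lambda>f. frechet_derivative (iter_deriv ?M Vs f) (at \<nu> within ?M)"
  have D: "(iter_deriv ?M Vs k has_derivative ?D k) (at \<nu> within ?M)" if "smooth_on ?M k" for k
    using smooth_on_imp_differentiable[OF smooth_on_iter_deriv[OF that]] Cons.prems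
    by (simp add: frechet_derivative_works[symmetric])
  have "((\<lambda>\<mu>. iter_deriv ?M Vs f \<mu> + A (iter_deriv ?M Vs g \<mu>)) has_derivative
      (\<lambda>w. ?D f w + A (?D g w))) (at \<nu> within ?M)"
    by (intro has_derivative_add bounded_linear.has_derivative[OF A] D f g)
  then have "(iter_deriv ?M Vs h has_derivative (\<lambda>w. ?D f w + A (?D g w))) (at \<nu> within ?M)"
    by (rule has_derivative_transform[rotated 2]) (use Cons in auto)
  from frechet_derivative_on_tangent[OF this Cons.prems(2)]
  show ?case using vector_fieldsD(2)[of V ?M \<nu>] Cons.prems by simp
qed

section \<open>Hamiltonian actions of one-parameter subgroups\<close>

text \<open>The action of a one-parameter subgroup is Hamiltonian whatever the subgroup is. The conjugates
  of \<open>t \<mapsto> exp (t X)\<close> by all points of the path are instances.\<close>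

locale one_parameter_subgroup =
  fixes g :: "real \<Rightarrow> complex^'n::finite^'n" and Y :: "'n su"
  assumes in_SU: "g t \<in> SU"
    and add: "g (s + t) = g s ** g t"
    and generator: "(g has_vector_derivative Rep_su Y) (at 0)"
begin

lemma zero: "g 0 = mat 1"
proof -
  have "ctranspose (g 0) ** g 0 = ctranspose (g 0) ** (g 0 ** g 0)"
    using add[of 0 0] by simp
  then show ?thesis by (simp add: matrix_mul_assoc SU_D[OF in_SU])
qed

lemma coAd_add: "coAd (g (s + t)) \<nu> = coAd (g s) (coAd (g t) \<nu>)"
  by (simp add: add coAd_mult in_SU)

lemma coAd_neg: "coAd (g (- t)) (coAd (g t) \<nu>) = \<nu>" "coAd (g t) (coAd (g (- t)) \<nu>) = \<nu>"
  by (simp_all add: coAd_add[symmetric] zero coAd_mat_1)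

text \<open>The group law moves the derivative at \<open>0\<close> to any time, on either side. The first form says
  that orbits are integral curves of the vector field \<open>coad Y\<close>; the second keeps the group element
  outermost, which makes the derivatives of the flow flows again.\<close>

lemma orbit_has_vector_derivative:
  "((\<lambda>t. coAd (g t) \<nu>) has_vector_derivative coad Y (coAd (g t) \<nu>)) (at t)"
  "((\<lambda>t. coAd (g t) \<nu>) has_vector_derivative coAd (g t) (coad Y \<nu>)) (at t)"
proof -
  have shift: "((\<lambda>s. coAd (g (s - t)) \<mu>) has_vector_derivative coad Y \<mu>) (at t)" for \<mu>
  proof -
    have "((\<lambda>s. s - t) has_vector_derivative 1) (at t)"
      by (auto intro!: derivative_eq_intros simp: has_real_derivative_iff_has_vector_derivative[symmetric])
    moreover have "((\<lambda>s. coAd (g s) \<mu>) has_vector_derivative coad Y \<mu>) (at (t - t))"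
      using coAd_has_vector_derivative[OF generator zero in_SU] by simp
    ultimately show ?thesis using vector_diff_chain_at by (fastforce simp: o_def)
  qed
  have "coAd (g (s - t)) (coAd (g t) \<nu>) = coAd (g s) \<nu>"
    "coAd (g t) (coAd (g (s - t)) \<nu>) = coAd (g s) \<nu>" for s
    by (simp_all add: coAd_add[symmetric])
  with shift[of "coAd (g t) \<nu>"]
    bounded_linear.has_vector_derivative[OF bounded_linear_coAd[OF in_SU] shift, of t \<nu>]
  show "((\<lambda>t. coAd (g t) \<nu>) has_vector_derivative coad Y (coAd (g t) \<nu>)) (at t)"
    "((\<lambda>t. coAd (g t) \<nu>) has_vector_derivative coAd (g t) (coad Y \<nu>)) (at t)"
    by simp_all
qed

text \<open>The affine map inside is there for iteration: a directional derivative of such a map is again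
  of this form, with another affine map. Joint differentiability follows from the expansion of
  the argument of the linear map \<open>coAd (g t)\<close>.\<close>

lemma flow_has_derivative:
  fixes L :: "'n su_dual \<Rightarrow> 'n su_dual"
  assumes "bounded_linear L"
  shows "((\<lambda>p. coAd (g (fst p)) (a + L (snd p))) has_derivative
    (\<lambda>h. coAd (g (fst p)) (fst h *\<^sub>R coad Y (a + L (snd p)) + L (snd h)))) (at p)"
proof -
  interpret L: bounded_linear L by fact
  have c: "((\<lambda>p. coAd (g (fst p)) \<nu>) has_derivative
      (\<lambda>h. fst h *\<^sub>R coAd (g (fst p)) (coad Y \<nu>))) (at p)" for \<nu>
    using has_derivative_compose[OF has_derivative_fst[OF has_derivative_ident]
      orbit_has_vector_derivative(2)[of \<nu> "fst p", unfolded has_vector_derivative_def]] .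
  have q: "((\<lambda>p. coord b (a + L (snd p))) has_derivative (\<lambda>h. coord b (L (snd h)))) (at p)" for b
    by (rule bounded_linear.has_derivative[OF bounded_linear_coord])
      (auto intro!: derivative_eq_intros L.has_derivative)
  have "((\<lambda>p. \<Sum>b\<in>Basis. coord b (a + L (snd p)) *\<^sub>R coAd (g (fst p)) (dual_vec b)) has_derivative
    (\<lambda>h. \<Sum>b\<in>Basis. coord b (a + L (snd p)) *\<^sub>R (fst h *\<^sub>R coAd (g (fst p)) (coad Y (dual_vec b)))
      + coord b (L (snd h)) *\<^sub>R coAd (g (fst p)) (dual_vec b))) (at p)"
    by (intro has_derivative_sum has_derivative_scaleR q c)
  moreover have "(\<Sum>b\<in>Basis. coord b (a + L (snd p)) *\<^sub>R (fst h *\<^sub>R coAd (g (fst p)) (coad Y (dual_vec b)))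
      + coord b (L (snd h)) *\<^sub>R coAd (g (fst p)) (dual_vec b))
     = coAd (g (fst p)) (fst h *\<^sub>R coad Y (a + L (snd p)) + L (snd h))" for h
  proof -
    interpret A: bounded_linear "coAd (g (fst p))" by (rule bounded_linear_coAd[OF in_SU])
    have "bounded_linear (\<lambda>\<nu>. fst h *\<^sub>R coAd (g (fst p)) (coad Y \<nu>))"
      by (intro bounded_linear_scaleR_right bounded_linear_compose[OF A.bounded_linear_axioms]
          bounded_linear_compose[OF bounded_linear_scaleR_right] bounded_linear_coad)
    from bounded_linear_apply_expansion[OF this, of "a + L (snd p)"]
      bounded_linear_apply_expansion[OF A.bounded_linear_axioms, of "L (snd h)"]
    show ?thesis by (simp add: sum.distrib A.add A.scaleR)
  qed
  ultimately show ?thesis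
    by (simp add: bounded_linear_apply_expansion[OF bounded_linear_coAd[OF in_SU], symmetric])
qed

lemma Ck_flow:
  fixes L :: "'n su_dual \<Rightarrow> 'n su_dual"
  shows "bounded_linear L \<Longrightarrow> Ck k UNIV (\<lambda>p. coAd (g (fst p)) (a + L (snd p)))"
proof (induction k arbitrary: a L)
  case 0
  have "isCont (\<lambda>p. coAd (g (fst p)) (a + L (snd p))) p" for p
    by (rule has_derivative_continuous[OF flow_has_derivative[OF 0]])
  then show ?case by (simp add: continuous_on_eq_continuous_at del: split_paired_All)
next
  case (Suc k)
  interpret Y: bounded_linear "coad Y" by (rule bounded_linear_coad)
  show ?case
  proof (rule Ck_SucI[OF open_UNIV flow_has_derivative[OF Suc.prems]])
    fix v :: "real \<times> 'n su_dual"
    have "bounded_linear (\<lambda>\<nu>. fst v *\<^sub>R coad Y (L \<nu>))"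
      by (intro bounded_linear_compose[OF bounded_linear_scaleR_right]
          bounded_linear_compose[OF bounded_linear_coad] Suc.prems)
    from Suc.IH[OF this, of "fst v *\<^sub>R coad Y a + L (snd v)"]
    show "Ck k UNIV (\<lambda>p. coAd (g (fst p)) (fst v *\<^sub>R coad Y (a + L (snd p)) + L (snd v)))"
      by (simp add: Y.add scaleR_add_right add_ac)
  qed
qed

definition act :: "'n su_dual set \<Rightarrow> real \<Rightarrow> 'n su_dual \<Rightarrow> 'n su_dual" where
  "act M t = (\<lambda>\<nu>\<in>M. coAd (g t) \<nu>)"

lemma smooth_on_act: "smooth_on (T \<times> M) (\<lambda>(t, \<nu>). act M t \<nu>)"
proof (rule smooth_onI_global)
  show "Ck k UNIV (\<lambda>p. coAd (g (fst p)) (0 + snd p))" for k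
    by (rule Ck_flow[OF bounded_linear_ident])
qed (auto simp: act_def)

lemma act_in_diffeos:
  "act (coadjoint_orbit \<eta>) t \<in> diffeos (coadjoint_orbit \<eta>)"
proof -
  let ?M = "coadjoint_orbit \<eta>"
  have closed: "coAd (g t) \<nu> \<in> ?M" if "\<nu> \<in> ?M" for t \<nu>
    by (rule coAd_in_coadjoint_orbit[OF in_SU that])
  have bij: "bij_betw (act ?M t) ?M ?M"
    by (rule bij_betw_byWitness[where f' = "act ?M (- t)"]) (auto simp: act_def coAd_neg closed)
  have smooth: "smooth_on ?M (coAd (g t))" for t
    by (rule smooth_on_bounded_linear[OF bounded_linear_coAd[OF in_SU]])
  have "coAd (g (- t)) \<nu> = inv_into ?M (act ?M t) \<nu>" if "\<nu> \<in> ?M" for \<nu>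
    by (rule inv_into_f_eq[symmetric, OF bij_betw_imp_inj_on[OF bij]])
      (use that in \<open>auto simp: act_def coAd_neg closed\<close>)
  then have "smooth_on ?M (inv_into ?M (act ?M t))"
    by (rule smooth_on_cong[OF smooth])
  moreover have "smooth_on ?M (act ?M t)"
    by (rule smooth_on_cong[OF smooth]) (simp add: act_def)
  ultimately show ?thesis using bij by (simp add: diffeos_def act_def)
qed

text \<open>The Hamiltonian is evaluation at the generator, \<open>\<nu> \<mapsto> \<nu>(Y)\<close>. It is linear, hence its own
  derivative, and its value on \<open>coad Z \<mu>\<close> is \<open>- \<mu>([Z, Y]) = \<mu>([Y, Z])\<close>, which is the
  Kirillov--Kostant--Souriau pairing of \<open>coad Y \<mu>\<close> with \<open>coad Z \<mu>\<close>.\<close>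

lemma hamiltonian_isotopy_act:
  "hamiltonian_isotopy (coadjoint_orbit \<eta>) (act (coadjoint_orbit \<eta>))"
proof -
  let ?M = "coadjoint_orbit \<eta>"
  have lin: "bounded_linear (\<lambda>\<nu>. blinfun_apply \<nu> Y)" by (rule blinfun.bounded_linear_left)
  have "ham_vector ?M (\<lambda>\<nu>. blinfun_apply \<nu> Y) \<mu> (coad Y \<mu>)" if \<mu>: "\<mu> \<in> ?M" for \<mu>
    unfolding ham_vector_def
  proof (intro conjI ballI)
    show "coad Y \<mu> \<in> tangent \<mu>" by (simp add: tangent_def)
    fix w assume w: "w \<in> tangent \<mu>"
    then obtain Z where Z: "w = coad Z \<mu>" by (auto simp: tangent_def)
    have "frechet_derivative (\<lambda>\<nu>. blinfun_apply \<nu> Y) (at \<mu> within ?M) w = blinfun_apply w Y"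
      by (rule frechet_derivative_on_tangent[OF bounded_linear_imp_has_derivative[OF lin] \<mu> w])
    also have "\<dots> = blinfun_apply \<mu> (bracket Y Z)"
      using bracket_commute[of Y Z] by (simp add: Z coad_apply blinfun.minus_right)
    finally show "kks \<mu> (coad Y \<mu>) w = frechet_derivative (\<lambda>\<nu>. blinfun_apply \<nu> Y) (at \<mu> within ?M) w"
      by (simp add: Z kks_coad)
  qed
  moreover have "((\<lambda>t. act ?M t \<nu>) has_vector_derivative coad Y (act ?M t \<nu>)) (at t within {0..1})"
    if "\<nu> \<in> ?M" for t \<nu>
    using that has_vector_derivative_at_within[OF orbit_has_vector_derivative(1)] by (simp add: act_def)
  moreover have "act ?M t \<nu> \<in> ?M" if "\<nu> \<in> ?M" for t \<nu>
    using that coAd_in_coadjoint_orbit[OF in_SU] by (simp add: act_def)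
  moreover have "smooth_on ({0..1} \<times> ?M) (\<lambda>(t :: real, \<nu>). blinfun_apply \<nu> Y)"
    unfolding case_prod_unfold
    by (rule smooth_on_bounded_linear) (rule bounded_linear_compose[OF lin bounded_linear_snd])
  moreover have "act ?M 0 = (\<lambda>\<nu>\<in>?M. \<nu>)" by (simp add: act_def zero coAd_mat_1)
  ultimately show ?thesis
    unfolding hamiltonian_isotopy_def using act_in_diffeos smooth_on_act
    by (intro conjI exI[of _ "\<lambda>_ \<nu>. blinfun_apply \<nu> Y"]) blast+
qed

lemma one_parameter_subgroup_scale: "one_parameter_subgroup (\<lambda>r. g (r * c)) (c *\<^sub>R Y)"
proof
  have "((\<lambda>r. r * c) has_vector_derivative c) (at 0)"
    by (auto intro!: derivative_eq_intros simp: has_real_derivative_iff_has_vector_derivative[symmetric])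
  from vector_diff_chain_at[OF this] generator
  show "((\<lambda>r. g (r * c)) has_vector_derivative Rep_su (c *\<^sub>R Y)) (at 0)"
    by (simp add: o_def scaleR_su.rep_eq)
qed (simp_all add: in_SU add distrib_right)

text \<open>The action at time \<open>t\<close> is the endpoint at time \<open>1\<close> of the isotopy of the subgroup run at speed
  \<open>t\<close>.\<close>

lemma act_in_Ham: "act (coadjoint_orbit \<eta>) t \<in> Ham (coadjoint_orbit \<eta>)"
proof -
  interpret scaled: one_parameter_subgroup "\<lambda>r. g (r * t)" "t *\<^sub>R Y"
    by (rule one_parameter_subgroup_scale)
  have "act (coadjoint_orbit \<eta>) t = scaled.act (coadjoint_orbit \<eta>) 1"
    by (simp add: act_def scaled.act_def)
  then show ?thesis using scaled.hamiltonian_isotopy_act unfolding Ham_def by blast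
qed

lemma ham_circle_action_act:
  assumes "g 1 = mat 1"
  shows "ham_circle_action (coadjoint_orbit \<eta>) (act (coadjoint_orbit \<eta>))"
  unfolding ham_circle_action_def
proof (intro conjI allI act_in_Ham smooth_on_act)
  show "act (coadjoint_orbit \<eta>) (s + t) =
      compose (coadjoint_orbit \<eta>) (act (coadjoint_orbit \<eta>) s) (act (coadjoint_orbit \<eta>) t)" for s t
    by (auto simp: act_def compose_def fun_eq_iff coAd_add coAd_in_coadjoint_orbit in_SU)
  show "act (coadjoint_orbit \<eta>) 1 = (\<lambda>\<nu>\<in>coadjoint_orbit \<eta>. \<nu>)"
    by (simp add: act_def assms coAd_mat_1)
qed

end

section \<open>Continuity of the action as a map into the Hamiltonian group\<close>

lemma smooth_on_diff:
  assumes "smooth_on S f" "smooth_on S g"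
  shows "smooth_on S (\<lambda>x. f x - g x)"
  unfolding smooth_on_def
proof
  fix x assume x: "x \<in> S"
  obtain U F where U: "open U" "x \<in> U" "\<And>k. Ck k U F" "\<And>y. y \<in> S \<inter> U \<Longrightarrow> F y = f y"
    using assms(1) x unfolding smooth_on_def by meson
  obtain T G where T: "open T" "x \<in> T" "\<And>k. Ck k T G" "\<And>y. y \<in> S \<inter> T \<Longrightarrow> G y = g y"
    using assms(2) x unfolding smooth_on_def by meson
  have op: "open (U \<inter> T)" using U T by blast
  have "Ck k (U \<inter> T) (\<lambda>y. F y + - G y)" for k
    by (intro Ck_add Ck_compose_linear[OF op bounded_linear_minus[OF bounded_linear_ident]] op
        Ck_subset[OF U(3)] Ck_subset[OF T(3)]) auto
  then show "\<exists>U H. open U \<and> x \<in> U \<and> (\<forall>k. Ck k U H) \<and> (\<forall>y\<in>S \<inter> U. H y = f y - g y)"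
    using op U(2,4) T(2,4) by (intro exI[of _ "U \<inter> T"] exI[of _ "\<lambda>y. F y + - G y"]) auto
qed

text \<open>The maps in question are restrictions of linear maps of the ambient space. The difference of
  the ones at \<open>p\<close> and \<open>q\<close> is therefore a linear map \<open>A\<close> applied to the identity of the orbit, and
  its iterated derivative is \<open>A\<close> applied to the iterated derivative \<open>J\<close> of the identity. As \<open>J\<close> is
  bounded on the compact orbit, every seminorm of the difference is at most a constant times the
  operator norm of \<open>A\<close>, which tends to \<open>0\<close> as \<open>p \<rightarrow> q\<close>.\<close>

lemma continuous_map_into_Ham_topology:
  fixes \<gamma> :: "'a::topological_space \<Rightarrow> complex^'n::finite^'n"
  assumes cont: "continuous_on T \<gamma>" and SU: "\<And>p. p \<in> T \<Longrightarrow> \<gamma> p \<in> SU"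
    and Ham: "\<And>p. p \<in> T \<Longrightarrow> (\<lambda>\<nu>\<in>coadjoint_orbit \<eta>. coAd (\<gamma> p) \<nu>) \<in> Ham (coadjoint_orbit \<eta>)"
  shows "continuous_map (top_of_set T) (Ham_topology (coadjoint_orbit \<eta>))
    (\<lambda>p. \<lambda>\<nu>\<in>coadjoint_orbit \<eta>. coAd (\<gamma> p) \<nu>)"
  unfolding Ham_topology_def
proof (rule continuous_on_generated_topo)
  let ?M = "coadjoint_orbit \<eta>" and ?act = "\<lambda>p. \<lambda>\<nu>\<in>coadjoint_orbit \<eta>. coAd (\<gamma> p) \<nu>"
  let ?S = "\<lambda>f Vs \<epsilon>. {g \<in> Ham ?M. \<forall>\<nu>\<in>?M. norm (iter_deriv ?M Vs (\<lambda>\<mu>. g \<mu> - f \<mu>) \<nu>) < \<epsilon>}"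
  let ?B = "{?S f Vs \<epsilon> | f Vs \<epsilon>. f \<in> Ham ?M \<and> set Vs \<subseteq> vector_fields ?M \<and> \<epsilon> > 0}"
  show "?act ` topspace (top_of_set T) \<subseteq> \<Union> ?B"
  proof clarsimp
    fix p assume p: "p \<in> T"
    have "?act p \<in> ?S (?act p) [] 1" using Ham[OF p] by simp
    moreover have "?S (?act p) [] 1 \<in> ?B" using Ham[OF p]
      by (intro CollectI exI[of _ "?act p"] exI[of _ "[]"] exI[of _ "1::real"] conjI refl) auto
    ultimately show "\<exists>U. (\<exists>f Vs \<epsilon>. U = ?S f Vs \<epsilon> \<and> f \<in> Ham ?M \<and> set Vs \<subseteq> vector_fields ?M \<and> 0 < \<epsilon>) \<and> ?act p \<in> U"
      by blast
  qed
  fix U assume "U \<in> ?B"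
  then obtain f Vs \<epsilon> where U: "U = ?S f Vs \<epsilon>" and f: "f \<in> Ham ?M" and Vs: "set Vs \<subseteq> vector_fields ?M"
    by blast
  have "f \<in> diffeos ?M" using f by (auto simp: Ham_def hamiltonian_isotopy_def)
  then have f_smooth: "smooth_on ?M f" by (simp add: diffeos_def)
  let ?J = "iter_deriv ?M Vs (\<lambda>\<mu>. \<mu>)"
  have id_smooth: "smooth_on ?M (\<lambda>\<mu>. \<mu>)" by (rule smooth_on_bounded_linear[OF bounded_linear_ident])
  have "bounded (?J ` ?M)"
    by (intro compact_imp_bounded compact_continuous_image compact_coadjoint_orbit
        smooth_on_imp_continuous_on smooth_on_iter_deriv id_smooth Vs)
  then obtain C where C: "\<And>\<nu>. \<nu> \<in> ?M \<Longrightarrow> norm (?J \<nu>) \<le> C" by (auto simp: bounded_iff)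
  obtain K :: "complex^'n^'n \<Rightarrow> complex^'n^'n \<Rightarrow> real"
    where K: "\<And>g h \<nu>. g \<in> SU \<Longrightarrow> h \<in> SU \<Longrightarrow> norm (coAd g \<nu> - coAd h \<nu>) \<le> K g h * norm \<nu>"
      "\<And>h. continuous_on UNIV (\<lambda>g. K g h)" "\<And>h. K h h = 0" "\<And>g h. K g h \<ge> 0"
    using coAd_diff_bound by blast
  show "openin (top_of_set T) (?act -` U \<inter> topspace (top_of_set T))"
  proof (subst openin_subopen, intro ballI)
    fix q assume "q \<in> ?act -` U \<inter> topspace (top_of_set T)"
    then have q: "q \<in> T" and qU: "\<And>\<nu>. \<nu> \<in> ?M \<Longrightarrow> norm (iter_deriv ?M Vs (\<lambda>\<mu>. ?act q \<mu> - f \<mu>) \<nu>) < \<epsilon>"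
      by (auto simp: U)
    let ?N = "\<lambda>\<nu>. iter_deriv ?M Vs (\<lambda>\<mu>. ?act q \<mu> - f \<mu>) \<nu>"
    have "smooth_on ?M (?act q)"
      by (rule smooth_on_cong[OF smooth_on_bounded_linear[OF bounded_linear_coAd[OF SU[OF q]]]]) simp
    then have diff_smooth: "smooth_on ?M (\<lambda>\<mu>. ?act q \<mu> - f \<mu>)"
      by (rule smooth_on_diff[OF _ f_smooth])
    have "continuous_on ?M (\<lambda>\<nu>. norm (?N \<nu>))"
      by (intro continuous_on_norm smooth_on_imp_continuous_on smooth_on_iter_deriv diff_smooth Vs)
    moreover have "?M \<noteq> {}" unfolding coadjoint_orbit_def by (rule ex_in_conv[THEN iffD1], rule exI, rule imageI[OF mat_1_in_SU])
    ultimately obtain \<nu>\<^sub>0 where \<nu>\<^sub>0: "\<nu>\<^sub>0 \<in> ?M" "\<And>\<nu>. \<nu> \<in> ?M \<Longrightarrow> norm (?N \<nu>) \<le> norm (?N \<nu>\<^sub>0)"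
      using continuous_attains_sup[OF compact_coadjoint_orbit] by meson
    \<comment> \<open>\<open>\<epsilon>\<close> minus the maximum of the seminorm at \<open>q\<close> is the room left for the linear part\<close>
    let ?W = "T \<inter> (\<lambda>p. K (\<gamma> p) (\<gamma> q) * C) -` {..< \<epsilon> - norm (?N \<nu>\<^sub>0)}"
    show "\<exists>W. openin (top_of_set T) W \<and> q \<in> W \<and> W \<subseteq> ?act -` U \<inter> topspace (top_of_set T)"
    proof (intro exI[of _ ?W] conjI)
      have "continuous_on T (\<lambda>p. K (\<gamma> p) (\<gamma> q) * C)"
        by (intro continuous_on_mult continuous_on_const continuous_on_compose2[OF K(2) cont]) auto
      then show "openin (top_of_set T) ?W" by (rule continuous_openin_preimage_gen) simp
      show "q \<in> ?W" using q qU[OF \<nu>\<^sub>0(1)] by (simp add: K(3))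
      show "?W \<subseteq> ?act -` U \<inter> topspace (top_of_set T)"
      proof
        fix p assume "p \<in> ?W"
        then have p: "p \<in> T" "K (\<gamma> p) (\<gamma> q) * C < \<epsilon> - norm (?N \<nu>\<^sub>0)" by auto
        let ?A = "\<lambda>\<mu>. coAd (\<gamma> p) \<mu> - coAd (\<gamma> q) \<mu>"
        have A: "bounded_linear ?A" by (intro bounded_linear_sub bounded_linear_coAd SU p q)
        have "norm (iter_deriv ?M Vs (\<lambda>\<mu>. ?act p \<mu> - f \<mu>) \<nu>) < \<epsilon>" if \<nu>: "\<nu> \<in> ?M" for \<nu>
        proof -
          have "iter_deriv ?M Vs (\<lambda>\<mu>. ?act p \<mu> - f \<mu>) \<nu> = ?N \<nu> + ?A (?J \<nu>)"
            by (rule iter_deriv_add_linear[OF diff_smooth id_smooth A _ Vs \<nu>]) simp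
          also have "norm \<dots> \<le> norm (?N \<nu>\<^sub>0) + K (\<gamma> p) (\<gamma> q) * C"
            using norm_triangle_ineq[of "?N \<nu>" "?A (?J \<nu>)"] \<nu>\<^sub>0(2)[OF \<nu>]
              K(1)[OF SU[OF p(1)] SU[OF q], of "?J \<nu>"]
              mult_left_mono[OF C[OF \<nu>] K(4)[of "\<gamma> p" "\<gamma> q"]] by linarith
          also have "\<dots> < \<epsilon>" using p(2) by simp
          finally show ?thesis .
        qed
        then show "p \<in> ?act -` U \<inter> topspace (top_of_set T)"
          using Ham[OF p(1)] p(1) by (simp add: U)
      qed
    qed
  qed
qed

lemma one_parameter_subgroup_conjugate:
  assumes k: "k \<in> SU" and x: "diag x \<in> su_matrices"
  shows "one_parameter_subgroup (\<lambda>t. k ** mat_exp (t *\<^sub>R diag x) ** ctranspose k) (Ad k (Abs_su (diag x)))"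
proof
  show "k ** mat_exp (t *\<^sub>R diag x) ** ctranspose k \<in> SU" for t
    by (intro SU_mult SU_ctranspose k mat_exp_in_SU x)
  show "k ** mat_exp ((s + t) *\<^sub>R diag x) ** ctranspose k =
    k ** mat_exp (s *\<^sub>R diag x) ** ctranspose k ** (k ** mat_exp (t *\<^sub>R diag x) ** ctranspose k)" for s t
  proof -
    have "k ** mat_exp (s *\<^sub>R diag x) ** ctranspose k ** (k ** mat_exp (t *\<^sub>R diag x) ** ctranspose k) =
      k ** mat_exp (s *\<^sub>R diag x) ** (ctranspose k ** k) ** mat_exp (t *\<^sub>R diag x) ** ctranspose k"
      by (simp only: matrix_mul_assoc)
    then show ?thesis by (simp add: SU_D[OF k] mat_exp_diag_add matrix_mul_assoc)
  qed
  have "((\<lambda>t. mat_exp (t *\<^sub>R diag x)) has_vector_derivative diag x) (at 0)"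
    using mat_exp_has_vector_derivative[of "diag x" 0] by (simp only: mat_exp_0 matrix_mul_rid)
  from bounded_linear.has_vector_derivative[OF bounded_linear_matrix_mult this, of k "ctranspose k"]
  show "((\<lambda>t. k ** mat_exp (t *\<^sub>R diag x) ** ctranspose k) has_vector_derivative
      Rep_su (Ad k (Abs_su (diag x)))) (at 0)"
    by (simp add: Rep_su_Ad[OF k] Abs_su_inverse[OF x] SU_inverse[OF k])
qed

section \<open>Equivalence of the circle actions\<close>

theorem corollary10:
  fixes \<eta> :: "'n::finite su_dual"
    and x x' :: "complex^'n"
  assumes "SU_diag \<subseteq> stabilizer \<eta>"
    and "diag x \<in> su_matrices" and "diag x' \<in> su_matrices"
    and "\<forall>j. \<exists>k::int. x $ j = 2 * of_real pi * \<i> * of_int k"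
    and "\<forall>j. \<exists>k::int. x' $ j = 2 * of_real pi * \<i> * of_int k"
    and "\<exists>\<tau>. \<tau> permutes UNIV \<and> (\<forall>j. x' $ j = x $ \<tau> j)"
  shows "circle_equiv (coadjoint_orbit \<eta>)
    (circle_action (coadjoint_orbit \<eta>) (diag x))
    (circle_action (coadjoint_orbit \<eta>) (diag x'))"
proof -
  let ?M = "coadjoint_orbit \<eta>"
  obtain \<tau> where \<tau>: "\<tau> permutes (UNIV :: 'n set)" "x' = (\<chi> j. x $ \<tau> j)"
    using assms(6) by (auto simp: vec_eq_iff)
  obtain k :: "real \<Rightarrow> complex^'n^'n" where k: "continuous_on UNIV k" "\<And>s. k s \<in> SU" "k 0 = mat 1"
    "k 1 ** diag x = diag x' ** k 1"
    using SU_path_to_permutation[OF \<tau>(1), of x] \<tau>(2) by blast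
  define \<gamma> where "\<gamma> = (\<lambda>s t. k s ** mat_exp (t *\<^sub>R diag x) ** ctranspose (k s))"
  define \<Psi> where "\<Psi> = (\<lambda>s t. \<lambda>\<nu>\<in>?M. coAd (\<gamma> s t) \<nu>)"
  have subgroup: "one_parameter_subgroup (\<gamma> s) (Ad (k s) (Abs_su (diag x)))" for s
    unfolding \<gamma>_def by (rule one_parameter_subgroup_conjugate[OF k(2) assms(2)])
  have "\<gamma> s 1 = mat 1" for s
    using mat_exp_diag_1[OF assms(4)] by (simp add: \<gamma>_def SU_D[OF k(2)])
  moreover have act: "one_parameter_subgroup.act (\<gamma> s) ?M = \<Psi> s" for s
    by (simp add: \<Psi>_def fun_eq_iff one_parameter_subgroup.act_def[OF subgroup])
  ultimately have circle: "ham_circle_action ?M (\<Psi> s)" for s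
    using one_parameter_subgroup.ham_circle_action_act[OF subgroup] by metis
  have "continuous_on UNIV (\<lambda>t. mat_exp (t *\<^sub>R diag x))"
    unfolding continuous_on_eq_continuous_at[OF open_UNIV]
    by (rule ballI, rule has_vector_derivative_continuous, rule mat_exp_has_vector_derivative)
  then have "continuous_on ({0..1} \<times> UNIV) (\<lambda>p :: real \<times> real. mat_exp (snd p *\<^sub>R diag x))"
    by (rule continuous_on_compose2) (auto intro: continuous_on_snd continuous_on_id)
  moreover have "continuous_on ({0..1} \<times> UNIV) (\<lambda>p :: real \<times> real. k (fst p))"
    by (rule continuous_on_compose2[OF k(1)]) (auto intro: continuous_on_fst continuous_on_id)
  ultimately have "continuous_on ({0..1} \<times> UNIV) (\<lambda>p. \<gamma> (fst p) (snd p))"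
    unfolding \<gamma>_def by (intro matrix_mult.continuous_on continuous_on_ctranspose)
  then have "continuous_map (top_of_set ({0..1} \<times> UNIV)) (Ham_topology ?M)
      (\<lambda>(s, t). \<Psi> s t)"
    unfolding \<Psi>_def case_prod_unfold
  proof (rule continuous_map_into_Ham_topology)
    show "\<gamma> (fst p) (snd p) \<in> SU" for p
      by (rule one_parameter_subgroup.in_SU[OF subgroup])
    show "(\<lambda>\<nu>\<in>?M. coAd (\<gamma> (fst p) (snd p)) \<nu>) \<in> Ham ?M" for p
      using circle[of "fst p"] by (simp add: ham_circle_action_def \<Psi>_def)
  qed
  moreover have "\<Psi> 0 = circle_action ?M (diag x)"
    by (simp add: fun_eq_iff \<Psi>_def \<gamma>_def k(3) circle_action_def)
  moreover have "\<Psi> 1 = circle_action ?M (diag x')"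
  proof -
    have "\<gamma> 1 t = mat_exp (t *\<^sub>R diag x') ** (k 1 ** ctranspose (k 1))" for t
      by (simp add: \<gamma>_def intertwines_mat_exp_diag[OF k(4)] matrix_mul_assoc)
    then show ?thesis
      by (simp add: fun_eq_iff \<Psi>_def circle_action_def SU_D[OF k(2)])
  qed
  ultimately show ?thesis
    unfolding circle_equiv_def using circle[of 0] circle[of 1] circle by (intro conjI exI[of _ \<Psi>]) simp_all
qed

end
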